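(* Let $n$ be a positive integer. The number of friezes of type $D_n$ is $$\sum_{m=1}^{n} d(m)\binom{2n-m-1}{n-m},$$ where $d(m)$ denotes the number of positive divisors of $m$.
   Context: A frieze of type $\Delta$ (a Dynkin type) is a ring homomorphism from the coefficient-free cluster algebra of type $\Delta$ to $\mathbb{Z}$ sending every cluster variable to a positive integer. Equivalently, fixing a Cartan matrix $C=(C_{i,j})$ of type $\Delta$ and an acyclic orientation of its Dynkin diagram, a frieze is a family of positive integers $a(j,m)$, $j\in\{1,\dots,n\}$, $m\in\mathbb{Z}$, with $a(j,m)a(j,m+1)=1+\big(\prod_{j\to i}a(i,m)^{|C_{i,j}|}\big)\big(\prod_{i\to j}a(i,m+1)^{|C_{i,j}|}\big)$. For type $D_n$, cluster variables correspond to tagged arcs in a once-punctured $n$-gon (Schiffler / Fomin–Shapiro–Thurston model), so a frieze of type $D_n$ is the same as an assignment of a positive integer weight to each tagged arc (boundary segments having weight $1$) satisfying all exchange relations (Ptolemy-type relations) of this cluster algebra. *)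

theory Defs
  imports Complex_Main "HOL-Library.FuncSet"
begin

text \<open>
  Vertices of a Dynkin diagram are \<open>1, \<dots>, n\<close>, and \<open>(i, j) \<in> E\<close> stands for an arrow
  \<open>i \<rightarrow> j\<close>. The condition \<^const>\<open>acyclic\<close> also rules out that an edge carries both directions.
\<close>

definition acyclic_orientation :: "nat \<Rightarrow> (nat \<Rightarrow> nat \<Rightarrow> int) \<Rightarrow> (nat \<times> nat) set \<Rightarrow> bool" where
  "acyclic_orientation n C E \<longleftrightarrow>
     E \<subseteq> {1..n} \<times> {1..n} \<and> acyclic E \<and>
     (\<forall>i\<in>{1..n}. \<forall>j\<in>{1..n}. i \<noteq> j \<longrightarrow> ((i, j) \<in> E \<or> (j, i) \<in> E \<longleftrightarrow> C i j \<noteq> 0))"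

text \<open>
  Families \<open>a(j, m)\<close> are made extensional in \<open>j\<close>, so that two of them are equal iff they agree
  on \<open>{1..n} \<times> \<int>\<close>; without this their number would be meaningless.
\<close>

definition friezes :: "nat \<Rightarrow> (nat \<Rightarrow> nat \<Rightarrow> int) \<Rightarrow> (nat \<times> nat) set \<Rightarrow> (nat \<Rightarrow> int \<Rightarrow> int) set" where
  "friezes n C E =
     {a \<in> {1..n} \<rightarrow>\<^sub>E (UNIV \<rightarrow> {0<..}).
        \<forall>j\<in>{1..n}. \<forall>m.
          a j m * a j (m + 1) =
            1 + (\<Prod>i\<in>{i. (j, i) \<in> E}. a i m ^ nat \<bar>C i j\<bar>)
              * (\<Prod>i\<in>{i. (i, j) \<in> E}. a i (m + 1) ^ nat \<bar>C i j\<bar>)}"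

text \<open>
  Type \<open>D\<^sub>n\<close>: the path \<open>1 - 2 - \<dots> - (n-1)\<close> together with a further vertex \<open>n\<close> joined to \<open>n-2\<close>.
  On \<open>{1..n}\<close> this yields the usual low-rank conventions \<open>D\<^sub>2 = A\<^sub>1 \<times> A\<^sub>1\<close> and \<open>D\<^sub>3 = A\<^sub>3\<close>.
\<close>

definition edge_D :: "nat \<Rightarrow> nat \<Rightarrow> nat \<Rightarrow> bool" where
  "edge_D n i j \<longleftrightarrow> (j = i + 1 \<and> j < n) \<or> (j = n \<and> i + 2 = n)"

definition cartan_D :: "nat \<Rightarrow> nat \<Rightarrow> nat \<Rightarrow> int" where
  "cartan_D n i j = (if i = j then 2 else if edge_D n i j \<or> edge_D n j i then -1 else 0)"

text \<open>
  \<open>D\<^sub>1\<close> is not a Dynkin type (and is \<^emph>\<open>not\<close> \<open>A\<^sub>1\<close>); it is understood through the once-punctured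
  monogon. There the only tagged arcs are the plain and the notched radius, and the product of their
  weights is the weight of the loop around the puncture, which here is the boundary segment, of
  weight 1. In general the shift \<open>m \<mapsto> m + 1\<close> rotates the polygon and switches the tags at the
  puncture, so that for \<open>n = 1\<close> the numbers \<open>a(1, m)\<close> alternate between the weights of these two
  radii.
\<close>

definition friezes_D :: "nat \<Rightarrow> (nat \<times> nat) set \<Rightarrow> (nat \<Rightarrow> int \<Rightarrow> int) set" where
  "friezes_D n E =
     (if n = 1
      then {a \<in> {1} \<rightarrow>\<^sub>E (UNIV \<rightarrow> {0<..}). \<forall>m. a 1 m * a 1 (m + 1) = 1}
      else friezes n (cartan_D n) E)"

end

theory Submission
  imports Defs
begin

text \<open>
  In the once-punctured \<open>n\<close>-gon, let \<open>l m\<close> and \<open>l' m\<close> be the weights of the plain and the notched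
  radius at the boundary vertex \<open>m\<close>. The exchange relations force \<open>l' = r l\<close> for a constant \<open>r\<close>, and
  every other arc, from \<open>m\<close> to \<open>m + j\<close>, has the weight
  \<open>r l(m) l(m + j) (u(m) + \<dots> + u(m + j - 1))\<close> with \<open>u(k) = 1 / (r l(k) l(k + 1))\<close>. The relations
  at the puncture say that \<open>l\<close> is \<open>n\<close>-periodic and that the \<open>u(k)\<close> sum to \<open>1\<close> over a period; integrality
  says that \<open>l(m)\<close> divides \<open>l(m - 1) + l(m + 1)\<close> and that \<open>r l(m)\<close> is an integer. So a frieze is a cyclic
  list \<open>l\<close> of positive integers with these two integrality properties.

  To such a list attach the numbers \<open>c(i) = \<lceil>l(i + 1) / l(i)\<rceil> - 1\<close>. If \<open>c(i - 1) > 0 = c(i)\<close>, then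
  \<open>l(i)\<close> exceeds \<open>l(i - 1)\<close> and is at least \<open>l(i + 1)\<close>; as it divides their sum, it equals
  \<open>l(i - 1) + l(i + 1)\<close>. Deleting \<open>l(i)\<close> preserves \<open>r\<close> and lowers \<open>n\<close> and \<open>c(i - 1)\<close> by one.
  This ends at a constant list \<open>k, \<dots>, k\<close> of length \<open>m = n - \<Sum> c(i)\<close>, which is admissible iff \<open>k\<close>
  divides \<open>m\<close>. Hence every \<open>c\<close> with sum \<open>n - m\<close> arises from exactly \<open>d(m)\<close> lists, and there are
  \<open>(2n - m - 1 choose n - m)\<close> such \<open>c\<close>.
\<close>

section \<open>Cyclic lists of radii\<close>

definition cyc_succ :: "'a list \<Rightarrow> nat \<Rightarrow> 'a" where
  "cyc_succ xs i = xs ! (Suc i mod length xs)"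

definition cyc_pred :: "'a list \<Rightarrow> nat \<Rightarrow> 'a" where
  "cyc_pred xs i = xs ! ((i + (length xs - 1)) mod length xs)"

text \<open>This is the constant \<open>r\<close> of a frieze: the steps
  \<open>1 / (r l(k) l(k + 1))\<close> have to add up to 1 over a full turn.\<close>

definition recip_sum :: "nat list \<Rightarrow> real" where
  "recip_sum xs = (\<Sum>i<length xs. 1 / (real (xs ! i) * real (cyc_succ xs i)))"

text \<open>The last condition makes the notched radii integers. The divisibility makes the other
  arcs integers, as they obey a linear recurrence with coefficients
  \<open>(l(m - 1) + l(m + 1)) / l(m)\<close>.\<close>

definition radii :: "nat \<Rightarrow> nat list set" where
  "radii n = {xs. length xs = n \<and> (\<forall>x\<in>set xs. 0 < x) \<and>
     (\<forall>i<n. xs ! i dvd cyc_pred xs i + cyc_succ xs i) \<and>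
     (\<forall>x\<in>set xs. recip_sum xs * real x \<in> \<int>)}"

text \<open>\<open>(s - 1) div x\<close> is \<open>\<lceil>s / x\<rceil> - 1\<close> for positive \<open>s\<close>, \<open>x\<close>.\<close>

definition excess :: "nat list \<Rightarrow> nat list" where
  "excess xs = map (\<lambda>i. (cyc_succ xs i - 1) div xs ! i) [0..<length xs]"

lemma length_excess [simp]: "length (excess xs) = length xs"
  by (simp add: excess_def)

lemma excess_nth: "i < length xs \<Longrightarrow> excess xs ! i = (cyc_succ xs i - 1) div xs ! i"
  by (simp add: excess_def)

section \<open>Invariance under rotation\<close>

lemma cyc_succ_rotate1:
  assumes "xs \<noteq> []"
  shows "cyc_succ (rotate1 xs) i = cyc_succ xs (Suc i mod length xs)"
  using assms by (simp add: cyc_succ_def nth_rotate1)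

lemma cyc_pred_rotate1:
  assumes "xs \<noteq> []"
  shows "cyc_pred (rotate1 xs) i = cyc_pred xs (Suc i mod length xs)"
  using assms by (simp add: cyc_pred_def nth_rotate1 mod_simps)

lemma bij_betw_Suc_mod:
  assumes "0 < n"
  shows "bij_betw (\<lambda>i. Suc i mod n) {..<n} {..<n}"
proof -
  have "inj_on (\<lambda>i. Suc i mod n) {..<n}"
    by (auto simp: inj_on_def mod_Suc split: if_splits)
  moreover have "(\<lambda>i. Suc i mod n) ` {..<n} \<subseteq> {..<n}"
    using assms by auto
  ultimately show ?thesis
    by (simp add: bij_betw_def endo_inj_surj)
qed

lemma recip_sum_rotate1: "recip_sum (rotate1 xs) = recip_sum xs"
proof (cases "xs = []")
  case False
  then have "0 < length xs" by simp
  have "recip_sum (rotate1 xs) =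
      (\<Sum>i<length xs. 1 / (real (xs ! (Suc i mod length xs)) * real (cyc_succ xs (Suc i mod length xs))))"
    using False by (simp add: recip_sum_def cyc_succ_rotate1 nth_rotate1)
  also have "\<dots> = recip_sum xs"
    unfolding recip_sum_def
    by (rule sum.reindex_bij_betw[OF bij_betw_Suc_mod[OF \<open>0 < length xs\<close>]])
  finally show ?thesis .
qed simp

lemma radii_rotate1:
  assumes "xs \<in> radii n"
  shows "rotate1 xs \<in> radii n"
proof (cases "xs = []")
  case False
  then show ?thesis
    using assms by (auto simp: radii_def recip_sum_rotate1 cyc_succ_rotate1 cyc_pred_rotate1 nth_rotate1)
qed (use assms in simp)

lemma excess_rotate1: "excess (rotate1 xs) = rotate1 (excess xs)"
proof (cases "xs = []")
  case False
  then show ?thesis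
    by (intro nth_equalityI)
      (auto simp: excess_nth nth_rotate1 cyc_succ_rotate1)
qed (simp add: excess_def)

definition fibre :: "nat list \<Rightarrow> nat list set" where
  "fibre cs = {xs \<in> radii (length cs). excess xs = cs}"

lemma fibre_rotate1: "fibre (rotate1 cs) = rotate1 ` fibre cs"
proof
  show "rotate1 ` fibre cs \<subseteq> fibre (rotate1 cs)"
    by (auto simp: fibre_def excess_rotate1 radii_rotate1)
next
  show "fibre (rotate1 cs) \<subseteq> rotate1 ` fibre cs"
  proof
    fix xs assume xs: "xs \<in> fibre (rotate1 cs)"
    \<comment> \<open>Rotating by one less than the length undoes \<open>rotate1\<close>.\<close>
    define ys where "ys = rotate (length xs - 1) xs"
    have eq: "rotate1 ys = xs"
      unfolding ys_def by (cases xs) (simp_all flip: rotate_Suc)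
    have "zs \<in> radii n \<Longrightarrow> rotate k zs \<in> radii n" for zs k n
      by (induction k) (simp_all add: radii_rotate1)
    then have "ys \<in> radii (length cs)"
      using xs by (simp add: ys_def fibre_def)
    moreover have "excess ys = cs"
      using xs eq by (metis (mono_tags, lifting) excess_rotate1 fibre_def inj_rotate1 inj_eq mem_Collect_eq)
    ultimately show "xs \<in> rotate1 ` fibre cs"
      using eq by (auto simp: fibre_def)
  qed
qed

lemma finite_card_fibre_rotate:
  "finite (fibre (rotate k cs)) \<longleftrightarrow> finite (fibre cs)"
  "card (fibre (rotate k cs)) = card (fibre cs)"
proof -
  have inj: "inj_on rotate1 A" for A :: "nat list set"
    using inj_rotate1 by (rule inj_on_subset) simp
  have "(finite (fibre (rotate k cs)) \<longleftrightarrow> finite (fibre cs)) \<and>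
      card (fibre (rotate k cs)) = card (fibre cs)"
    by (induction k) (simp_all add: fibre_rotate1 card_image[OF inj] finite_image_iff[OF inj])
  then show "finite (fibre (rotate k cs)) \<longleftrightarrow> finite (fibre cs)"
    "card (fibre (rotate k cs)) = card (fibre cs)" by simp_all
qed

text \<open>Going backwards around the cycle from some zero, the first nonzero entry met is followed
  by a zero. Rotation puts this pair at the end, where \<open>fibre_snoc\<close> deletes an
  entry.\<close>

lemma rotate_descent:
  assumes "0 \<in> set cs" and "\<exists>c\<in>set cs. c \<noteq> (0::nat)"
  obtains k ds a where "rotate k cs = ds @ [Suc a, 0]"
proof -
  obtain u v where uv: "cs = u @ 0 # v"
    using assms(1) split_list by metis
  then have "\<exists>x\<in>set (v @ u). x \<noteq> 0"
    using assms(2) by auto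
  then obtain w c z where wz: "v @ u = w @ c # z" "c \<noteq> 0" "\<forall>x\<in>set z. \<not> x \<noteq> 0"
    by (rule split_list_last_propE) blast
  then obtain a where a: "c = Suc a" by (cases c) auto
  \<comment> \<open>The entry after \<open>c\<close> is a zero even if \<open>z\<close> is empty,
    because then it is the zero at which \<open>cs\<close> was cut.\<close>
  have "\<exists>r. z @ [0] = 0 # r"
    using wz(3) by (cases z) auto
  then obtain r where r: "z @ [0] = 0 # r" by blast
  have "rotate (Suc (length u)) cs = rotate (length (u @ [0])) ((u @ [0]) @ v)"
    by (simp add: uv)
  also have "\<dots> = v @ u @ [0]"
    by (rule rotate_append)
  also have "\<dots> = (v @ u) @ [0]" by simp
  also have "\<dots> = (w @ [Suc a, 0]) @ r"
    unfolding wz(1) using r a by simp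
  finally have "rotate (length (w @ [Suc a, 0]) + Suc (length u)) cs = r @ (w @ [Suc a, 0])"
    by (simp only: rotate_rotate[symmetric] rotate_append)
  then show thesis using that[of _ "r @ w" a] unfolding append_assoc by blast
qed

section \<open>Inserting the sum of two neighbours\<close>

lemma cyc_succ_snoc:
  assumes "i < length zs"
  shows "cyc_succ (zs @ [last zs + hd zs]) i =
    cyc_succ zs i + (if Suc i = length zs then zs ! i else (0::nat))"
proof (cases "Suc i = length zs")
  case True
  then have "zs \<noteq> []" "i = length zs - 1" by auto
  then show ?thesis using True
    by (simp add: cyc_succ_def last_conv_nth hd_conv_nth nth_append)
next
  case False
  then show ?thesis using assms by (simp add: cyc_succ_def nth_append)
qed

lemma cyc_pred_snoc:
  assumes "i < length zs"
  shows "cyc_pred (zs @ [last zs + hd zs]) i =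
    cyc_pred zs i + (if i = 0 then zs ! i else (0::nat))"
proof (cases i)
  case 0
  then show ?thesis using assms
    by (cases zs rule: rev_cases) (auto simp: cyc_pred_def hd_conv_nth nth_append)
next
  case (Suc k)
  have "(Suc k + length zs) mod Suc (length zs) = k"
    unfolding add_Suc_shift mod_add_self2 using assms Suc by simp
  moreover have "(Suc k + (length zs - 1)) mod length zs = k"
  proof -
    have "Suc k + (length zs - 1) = k + length zs" using assms by simp
    then show ?thesis using assms Suc by simp
  qed
  ultimately show ?thesis
    using Suc assms by (simp add: cyc_pred_def nth_append)
qed

lemma cyc_snoc_last:
  assumes "zs \<noteq> []"
  shows "cyc_succ (zs @ [y]) (length zs) = hd zs" "cyc_pred (zs @ [y]) (length zs) = last zs"
proof -
  have "(length zs + length zs) mod Suc (length zs) = length zs - 1"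
  proof -
    have "length zs + length zs = (length zs - 1) + Suc (length zs)" using assms by simp
    then show ?thesis by (simp only: mod_add_self2) simp
  qed
  then show "cyc_succ (zs @ [y]) (length zs) = hd zs" "cyc_pred (zs @ [y]) (length zs) = last zs"
    using assms by (simp_all add: cyc_succ_def cyc_pred_def nth_append hd_conv_nth last_conv_nth)
qed

text \<open>Splitting the term of the pair \<open>a\<close>, \<open>b\<close> uses
  \<open>1/(a(a+b)) + 1/((a+b)b) = 1/(ab)\<close>; all other terms stay.\<close>

lemma recip_sum_snoc:
  assumes "zs \<noteq> []" and pos: "\<forall>x\<in>set zs. 0 < x"
  shows "recip_sum (zs @ [last zs + hd zs]) = recip_sum zs"
proof -
  obtain N where N: "length zs = Suc N" using assms(1) by (cases zs) auto
  let ?y = "last zs + hd zs"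
  have l: "last zs = zs ! N" "hd zs = zs ! 0"
    using N assms(1) by (simp_all add: last_conv_nth hd_conv_nth)
  have p: "0 < last zs" "0 < hd zs" using assms by simp_all
  have s: "cyc_succ zs N = zs ! 0" "cyc_succ (zs @ [?y]) N = ?y"
    using cyc_succ_snoc[of N zs] N l by (simp_all add: cyc_succ_def)
  have t: "cyc_succ (zs @ [zs ! N + zs ! 0]) i = cyc_succ zs i" if "i < N" for i
    using cyc_succ_snoc[of i zs] N l that by simp
  have "recip_sum (zs @ [?y]) =
      (\<Sum>i<N. 1 / (real (zs ! i) * real (cyc_succ zs i)))
      + 1 / (real (last zs) * real ?y) + 1 / (real ?y * real (hd zs))"
    using N s cyc_snoc_last[OF assms(1), of ?y] l
    by (auto simp: recip_sum_def nth_append t intro!: sum.cong)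
  moreover have "recip_sum zs = (\<Sum>i<N. 1 / (real (zs ! i) * real (cyc_succ zs i)))
      + 1 / (real (last zs) * real (hd zs))"
    using N s l by (simp add: recip_sum_def)
  moreover have "1 / (real (last zs) * real ?y) + 1 / (real ?y * real (hd zs))
      = 1 / (real (last zs) * real (hd zs))"
  proof -
    have "1 / (a * (a + b)) + 1 / ((a + b) * b) = 1 / (a * b)" if "0 < a" "0 < b" for a b :: real
    proof -
      have "1 / (a * (a + b)) + 1 / ((a + b) * b) = (b + a) / (a * b * (a + b))"
        using that by (simp add: divide_simps)
      then show ?thesis using that by (simp add: add.commute)
    qed
    then show ?thesis using p by simp
  qed
  ultimately show ?thesis by linarith
qed

text \<open>An old entry adjacent to the new one has its neighbour sum increased by a multiple of
  itself, the new entry equals its neighbour sum, and \<open>recip_sum\<close> stays; the last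
  condition passes to the new entry by additivity.\<close>

lemma radii_snoc_iff:
  assumes "zs \<noteq> []"
  shows "zs @ [last zs + hd zs] \<in> radii (Suc (length zs)) \<longleftrightarrow> zs \<in> radii (length zs)"
proof (cases "\<forall>x\<in>set zs. 0 < x")
  case True
  let ?y = "last zs + hd zs"
  have "zs ! i dvd cyc_pred (zs @ [?y]) i + cyc_succ (zs @ [?y]) i \<longleftrightarrow>
      zs ! i dvd cyc_pred zs i + cyc_succ zs i" if "i < length zs" for i
  proof -
    \<comment> \<open>\<open>b\<close> counts the sides on which the new entry is adjacent to
      \<open>zs ! i\<close>; both count if \<open>zs\<close> is a single entry.\<close>
    have "\<exists>b. cyc_pred (zs @ [?y]) i + cyc_succ (zs @ [?y]) i =
        (cyc_pred zs i + cyc_succ zs i) + zs ! i * b"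
      unfolding cyc_succ_snoc[OF that] cyc_pred_snoc[OF that]
      by (rule exI[of _ "(if i = 0 then 1 else 0) + (if Suc i = length zs then 1 else 0)"]) auto
    then show ?thesis by (metis dvd_add_left_iff dvd_triv_left)
  qed
  moreover have "recip_sum zs * real ?y \<in> \<int>" if "\<forall>x\<in>set zs. recip_sum zs * real x \<in> \<int>"
    using that assms by (simp add: distrib_left)
  ultimately show ?thesis
    using True assms unfolding radii_def recip_sum_snoc[OF assms True, symmetric]
    by (auto simp: All_less_Suc recip_sum_snoc nth_append cyc_snoc_last)
qed (auto simp: radii_def)

text \<open>Adding \<open>last zs\<close> to the successor of \<open>last zs\<close> raises the
  quotient there by one; the new entry exceeds its successor \<open>hd zs\<close>, so its quotient
  vanishes.\<close>

lemma excess_snoc: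
  assumes "zs \<noteq> []" and pos: "\<forall>x\<in>set zs. 0 < x"
  shows "excess (zs @ [last zs + hd zs]) = butlast (excess zs) @ [Suc (last (excess zs)), 0]"
proof -
  obtain N where N: "length zs = Suc N" using assms(1) by (cases zs) auto
  let ?y = "last zs + hd zs"
  have l: "last zs = zs ! N" "hd zs = zs ! 0"
    using N assms(1) by (simp_all add: last_conv_nth hd_conv_nth)
  have p: "0 < last zs" "0 < hd zs" using assms by simp_all
  have s: "cyc_succ zs N = zs ! 0" "cyc_succ (zs @ [?y]) N = ?y"
    using cyc_succ_snoc[of N zs] N l by (simp_all add: cyc_succ_def)
  have t: "cyc_succ (zs @ [zs ! N + zs ! 0]) i = cyc_succ zs i" if "i < N" for i
    using cyc_succ_snoc[of i zs] N l that by simp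
  have "(?y - 1) div last zs = Suc ((hd zs - 1) div last zs)"
  proof -
    have "?y - 1 = (hd zs - 1) + last zs" using p by simp
    then show ?thesis using p by (simp only: div_add_self2)
  qed
  moreover have "(hd zs - 1) div ?y = 0" using p by simp
  moreover have "excess zs = map (\<lambda>i. (cyc_succ zs i - 1) div zs ! i) [0..<N] @ [(hd zs - 1) div last zs]"
    using N s l by (simp add: excess_def)
  moreover have "excess (zs @ [?y]) = map (\<lambda>i. (cyc_succ zs i - 1) div zs ! i) [0..<N]
      @ [(?y - 1) div last zs, (hd zs - 1) div ?y]"
    using N s l cyc_snoc_last[OF assms(1), of ?y]
    by (auto simp: excess_def nth_append t)
  ultimately show ?thesis by simp
qed

text \<open>Deleting the final entry \<open>y\<close> inverts the insertion: the excess
  \<open>Suc a\<close> forces \<open>last zs < y\<close>, the excess 0 forces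
  \<open>hd zs \<le> y\<close>, so \<open>y\<close> divides the positive number
  \<open>last zs + hd zs < 2y\<close> and equals it.\<close>

lemma fibre_snoc:
  "fibre (ds @ [Suc a, 0]) = (\<lambda>zs. zs @ [last zs + hd zs]) ` fibre (ds @ [a])"
proof
  show "(\<lambda>zs. zs @ [last zs + hd zs]) ` fibre (ds @ [a]) \<subseteq> fibre (ds @ [Suc a, 0])"
  proof (clarify)
    fix zs assume "zs \<in> fibre (ds @ [a])"
    then have zs: "zs \<in> radii (Suc (length ds))" "excess zs = ds @ [a]"
      by (simp_all add: fibre_def)
    then have "length zs = Suc (length ds)" "\<forall>x\<in>set zs. 0 < x" "zs \<noteq> []"
      by (auto simp: radii_def)
    then show "zs @ [last zs + hd zs] \<in> fibre (ds @ [Suc a, 0])"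
      using zs radii_snoc_iff[of zs] by (simp add: fibre_def excess_snoc)
  qed
next
  show "fibre (ds @ [Suc a, 0]) \<subseteq> (\<lambda>zs. zs @ [last zs + hd zs]) ` fibre (ds @ [a])"
  proof
    fix xs assume "xs \<in> fibre (ds @ [Suc a, 0])"
    then have xs: "xs \<in> radii (Suc (Suc (length ds)))" "excess xs = ds @ [Suc a, 0]"
      by (simp_all add: fibre_def)
    then have len: "length xs = Suc (Suc (length ds))" and pos: "\<forall>x\<in>set xs. 0 < x"
      by (auto simp: radii_def)
    then obtain zs y where zy: "xs = zs @ [y]" by (cases xs rule: rev_cases) auto
    define N where "N = length ds"
    have lz: "length zs = Suc N" "zs \<noteq> []" using len zy by (auto simp: N_def)
    have l: "last zs = zs ! N" using lz by (simp add: last_conv_nth)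
    have p: "0 < last zs" "0 < hd zs" "0 < y" using lz pos zy by simp_all
    have "(y - 1) div last zs = Suc a"
      using arg_cong[OF xs(2), of "\<lambda>c. c ! N"] lz l zy
      by (simp add: excess_nth N_def nth_append cyc_succ_def)
    then have 1: "last zs < y"
      using p by (metis Suc_neq_Zero Suc_pred' div_less less_Suc_eq_le linorder_not_less)
    have "(hd zs - 1) div y = 0"
      using arg_cong[OF xs(2), of "\<lambda>c. c ! Suc N"] lz zy cyc_snoc_last(1)[OF lz(2), of y]
      by (simp add: excess_nth N_def nth_append)
    then have 2: "hd zs \<le> y"
      using p by (metis Suc_pred' bot_nat_0.not_eq_extremum div_eq_0_iff less_eq_Suc_le)
    have "y dvd last zs + hd zs"
      using xs(1) lz cyc_snoc_last[OF lz(2), of y]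
      by (force simp: radii_def zy N_def nth_append)
    then obtain q where q: "last zs + hd zs = y * q" by blast
    have "q = 1"
    proof -
      have "y * q < y * 2" "0 < y * q" using 1 2 p q by linarith+
      then have "q < 2" "0 < q" by simp_all
      then show ?thesis by simp
    qed
    then have y: "y = last zs + hd zs" using q by simp
    have "zs \<in> radii (length zs)"
      using radii_snoc_iff[OF lz(2)] xs(1) lz by (simp add: zy y N_def)
    moreover have "excess zs = ds @ [a]"
    proof -
      have *: "butlast (excess zs) @ [Suc (last (excess zs)), 0] = ds @ [Suc a, 0]"
        using excess_snoc[OF lz(2)] pos xs(2) by (simp add: zy y)
      then have "butlast (excess zs) = ds" "last (excess zs) = a" by simp_all
      moreover have "excess zs \<noteq> []" using lz by (metis length_0_conv length_excess)
      ultimately show ?thesis by (metis append_butlast_last_id)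
    qed
    ultimately have "zs \<in> fibre (ds @ [a])"
      using lz by (simp add: fibre_def N_def)
    then show "xs \<in> (\<lambda>zs. zs @ [last zs + hd zs]) ` fibre (ds @ [a])"
      using zy y by blast
  qed
qed

section \<open>Cardinalities of the fibres\<close>

lemma cyc_const:
  assumes "i < length xs" "xs = replicate n k"
  shows "cyc_succ xs i = k" "cyc_pred xs i = k"
  using assms by (auto simp: cyc_succ_def cyc_pred_def)

lemma recip_sum_replicate: "recip_sum (replicate n k) = real n / (real k)\<^sup>2"
  by (simp add: recip_sum_def cyc_const[OF _ refl] power2_eq_square)

text \<open>Zero excess means that no entry is smaller than its successor, so the list is constant
  around the cycle. For \<open>n\<close> copies of \<open>k\<close> the remaining condition is that
  \<open>r k = n / k\<close> be an integer.\<close>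

lemma fibre_zero:
  assumes "0 < n"
  shows "fibre (replicate n 0) = (\<lambda>k. replicate n k) ` {k. k dvd n}"
proof
  show "(\<lambda>k. replicate n k) ` {k. k dvd n} \<subseteq> fibre (replicate n 0)"
  proof clarify
    fix k assume "k dvd n"
    then have k: "0 < k" "real n / (real k)\<^sup>2 * real k = real (n div k)"
      using assms by (auto simp: dvd_pos_nat real_of_nat_div power2_eq_square dest: dvd_imp_le)
    have "excess (replicate n k) = replicate n 0"
      using k by (intro nth_equalityI) (auto simp: excess_nth cyc_const[OF _ refl])
    then show "replicate n k \<in> fibre (replicate n 0)"
      using k by (auto simp: fibre_def radii_def recip_sum_replicate cyc_const[OF _ refl])
  qed
next
  show "fibre (replicate n 0) \<subseteq> (\<lambda>k. replicate n k) ` {k. k dvd n}"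
  proof
    fix xs assume "xs \<in> fibre (replicate n 0)"
    then have xs: "xs \<in> radii n" "excess xs = replicate n 0" by (simp_all add: fibre_def)
    then have len: "length xs = n" and pos: "\<forall>x\<in>set xs. 0 < x" by (auto simp: radii_def)
    have le: "cyc_succ xs i \<le> xs ! i" if "i < n" for i
    proof -
      have "(cyc_succ xs i - 1) div xs ! i = 0"
        using arg_cong[OF xs(2), of "\<lambda>c. c ! i"] that len by (simp add: excess_nth)
      moreover have "0 < xs ! i" using pos that len by simp
      ultimately show ?thesis by (auto simp: div_eq_0_iff)
    qed
    have dec: "xs ! (i + d) \<le> xs ! i" if "i + d < n" for i d
      using that
    proof (induction d)
      case (Suc d)
      then show ?case using le[of "i + d"] len by (simp add: cyc_succ_def)
    qed simp
    have const: "xs ! i = xs ! 0" if "i < n" for i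
    proof (rule antisym)
      show "xs ! i \<le> xs ! 0" using dec[of 0 i] that by simp
      have "xs ! 0 \<le> xs ! (n - 1)" using le[of "n - 1"] len assms by (simp add: cyc_succ_def)
      also have "\<dots> \<le> xs ! i" using dec[of i "n - 1 - i"] that by simp
      finally show "xs ! 0 \<le> xs ! i" .
    qed
    define k where "k = xs ! 0"
    have eq: "xs = replicate n k"
    proof (rule nth_equalityI)
      show "xs ! i = replicate n k ! i" if "i < length xs" for i
        using const[of i] that len by (simp only: k_def nth_replicate)
    qed (simp add: len)
    have k: "0 < k" using pos len assms by (simp add: k_def)
    have "real n / (real k)\<^sup>2 * real k \<in> \<int>"
      using xs(1) assms recip_sum_replicate[of n k] unfolding eq by (simp add: radii_def)
    then have "real n / real k \<in> \<int>" using k by (simp add: power2_eq_square)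
    then obtain z where "real n / real k = of_int z" by (auto elim: Ints_cases)
    then have "real_of_int (int n) = real_of_int (z * int k)" using k by (simp add: field_simps)
    then have "int n = z * int k" by (simp only: of_int_eq_iff)
    then have "k dvd n" by (metis dvd_triv_right int_dvd_int_iff)
    then show "xs \<in> (\<lambda>k. replicate n k) ` {k. k dvd n}" using eq by blast
  qed
qed

text \<open>At a maximal entry the successor is no larger, so the excess there is 0.\<close>

lemma fibre_no_zero:
  assumes "cs \<noteq> []" "0 \<notin> set cs"
  shows "fibre cs = {}"
proof -
  have False if xs: "xs \<in> fibre cs" for xs
  proof -
    have len: "length xs = length cs" and c: "excess xs = cs" and ne: "xs \<noteq> []"
      and pos: "\<forall>x\<in>set xs. 0 < x"
      using xs assms(1) by (auto simp: fibre_def radii_def excess_def)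
    obtain i where i: "i < length xs" "xs ! i = Max (set xs)"
      using ne by (metis List.finite_set Max_in in_set_conv_nth set_empty)
    have "cyc_succ xs i \<le> xs ! i" "0 < xs ! i"
      using ne i pos by (simp_all add: cyc_succ_def)
    then have "excess xs ! i = 0" using i(1) by (simp add: excess_nth)
    then show False using assms(2) c i(1) len by (metis nth_mem)
  qed
  then show ?thesis by blast
qed

text \<open>Induction on the length. Without zeros the fibre is empty and the sum is at least the
  length; with zeros only, \<open>fibre_zero\<close> applies; otherwise a rotation and a deletion
  lower both length and sum by one and so preserve their difference.\<close>

lemma card_fibre:
  assumes "cs \<noteq> []"
  shows "finite (fibre cs) \<and>
    card (fibre cs) = (if sum_list cs < length cs then card {k. k dvd (length cs - sum_list cs)} else 0)"
  using assms
proof (induction "length cs" arbitrary: cs)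
  case (Suc n)
  consider "0 \<notin> set cs" | "\<forall>c\<in>set cs. c = 0" | "0 \<in> set cs" "\<exists>c\<in>set cs. c \<noteq> 0"
    by blast
  then show ?case
  proof cases
    case 1
    have "length xs \<le> sum_list xs" if "0 \<notin> set xs" for xs :: "nat list"
      using that by (induction xs) auto
    then show ?thesis using 1 Suc.prems by (simp add: fibre_no_zero leD)
  next
    case 2
    then have cs: "cs = replicate (length cs) 0" by (simp add: replicate_length_same)
    have pos: "0 < length cs" using Suc.prems by simp
    have inj: "inj_on (\<lambda>k. replicate (length cs) k) A" for A :: "nat set"
      using pos by (auto simp: inj_on_def)
    have z: "sum_list cs = 0" using 2 by simp
    have "sum_list cs < length cs" "length cs - sum_list cs = length cs"
      unfolding z using pos by simp_all
    moreover have "finite {k. k dvd length cs}" using pos by simp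
    moreover have "fibre cs = (\<lambda>k. replicate (length cs) k) ` {k. k dvd length cs}"
      using fibre_zero[OF pos] cs by metis
    ultimately show ?thesis by (simp only: card_image[OF inj] finite_imageI if_True)
  next
    case 3
    then obtain k ds a where r: "rotate k cs = ds @ [Suc a, 0]" by (rule rotate_descent)
    have len: "length cs = Suc (length (ds @ [a]))"
      using arg_cong[OF r, of length] by simp
    have sum_list_rotate1: "sum_list (rotate1 xs) = sum_list xs" for xs :: "nat list"
      by (cases xs) simp_all
    have "sum_list cs = sum_list (rotate k cs)"
      by (induction k) (simp_all add: sum_list_rotate1)
    then have sum: "sum_list cs = Suc (sum_list (ds @ [a]))" by (simp add: r)
    have inj: "inj_on (\<lambda>zs. zs @ [last zs + hd zs]) A" for A :: "nat list set"
      by (auto simp: inj_on_def)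
    have "finite (fibre (ds @ [a])) \<and> card (fibre (ds @ [a])) =
      (if sum_list (ds @ [a]) < length (ds @ [a])
       then card {k. k dvd (length (ds @ [a]) - sum_list (ds @ [a]))} else 0)"
      using Suc.hyps(2) len by (intro Suc.hyps(1)) simp_all
    moreover have "finite (fibre cs) \<longleftrightarrow> finite (fibre (ds @ [a]))"
      "card (fibre cs) = card (fibre (ds @ [a]))"
      using finite_card_fibre_rotate[of k cs]
      by (simp_all only: r fibre_snoc card_image[OF inj] finite_image_iff[OF inj])
    ultimately show ?thesis
      unfolding len sum by (simp only: diff_Suc_Suc Suc_less_eq)
  qed
qed simp

text \<open>The fibres of \<open>excess\<close> partition \<open>radii n\<close>; they are grouped
  by \<open>m = n - sum_list cs\<close>, and stars and bars counts the \<open>cs\<close> in each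
  group.\<close>

lemma card_radii:
  assumes "0 < n"
  shows "card (radii n) = (\<Sum>m=1..n. card {k. k dvd m} * ((2 * n - m - 1) choose (n - m)))"
proof -
  define comps where "comps m = {cs :: nat list. length cs = n \<and> sum_list cs = n - m}" for m
  have fin: "finite (comps m)" for m
  proof (rule finite_subset)
    show "comps m \<subseteq> {cs. set cs \<subseteq> {..n} \<and> length cs = n}"
      unfolding comps_def using member_le_sum_list by fastforce
  qed (simp add: finite_lists_length_eq)
  have card: "card (comps m) = (2 * n - m - 1) choose (n - m)" if "m \<in> {1..n}" for m
  proof -
    have "n - m + n - 1 = 2 * n - m - 1" using that by auto
    then show ?thesis using card_length_sum_list[of n "n - m"] by (simp add: comps_def)
  qed
  have fib: "finite (fibre cs)" "card (fibre cs) = card {k. k dvd m}"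
    if "cs \<in> comps m" "m \<in> {1..n}" for cs m
  proof -
    have "cs \<noteq> []" "sum_list cs < length cs" "length cs - sum_list cs = m"
      using that assms by (auto simp: comps_def)
    then show "finite (fibre cs)" "card (fibre cs) = card {k. k dvd m}"
      using card_fibre[of cs] by simp_all
  qed
  have un: "radii n = (\<Union>m\<in>{1..n}. \<Union>cs\<in>comps m. fibre cs)"
  proof (intro equalityI subsetI)
    fix xs assume xs: "xs \<in> radii n"
    then have len: "length xs = n" by (simp add: radii_def)
    then have mem: "xs \<in> fibre (excess xs)" using xs by (simp add: fibre_def)
    have ne: "excess xs \<noteq> []" using len assms by (metis length_excess list.size(3) less_irrefl)
    have "sum_list (excess xs) < n"
      using card_fibre[OF ne] mem len by (auto split: if_splits)
    then have "excess xs \<in> comps (n - sum_list (excess xs))" "n - sum_list (excess xs) \<in> {1..n}"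
      using len by (auto simp: comps_def)
    then show "xs \<in> (\<Union>m\<in>{1..n}. \<Union>cs\<in>comps m. fibre cs)"
      using mem by blast
  qed (auto simp: comps_def fibre_def)
  have dis: "fibre cs \<inter> fibre ds = {}" if "cs \<noteq> ds" for cs ds
    using that by (auto simp: fibre_def)
  have inner: "card (\<Union>cs\<in>comps m. fibre cs) = card {k. k dvd m} * ((2 * n - m - 1) choose (n - m))"
    if "m \<in> {1..n}" for m
  proof -
    have "card (\<Union>cs\<in>comps m. fibre cs) = (\<Sum>cs\<in>comps m. card (fibre cs))"
      using fin fib(1) that dis by (intro card_UN_disjoint) auto
    also have "\<dots> = (\<Sum>cs\<in>comps m. card {k. k dvd m})"
      using fib(2) that by (intro sum.cong) auto
    finally show ?thesis using card[OF that] by simp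
  qed
  have "card (radii n) = (\<Sum>m\<in>{1..n}. card (\<Union>cs\<in>comps m. fibre cs))"
    unfolding un
  proof (rule card_UN_disjoint)
    show "\<forall>m\<in>{1..n}. finite (\<Union>cs\<in>comps m. fibre cs)"
      using fin fib(1) by (intro ballI finite_UN_I) auto
    show "\<forall>i\<in>{1..n}. \<forall>j\<in>{1..n}. i \<noteq> j \<longrightarrow>
        (\<Union>cs\<in>comps i. fibre cs) \<inter> (\<Union>cs\<in>comps j. fibre cs) = {}"
    proof (intro ballI impI)
      fix i j assume "i \<in> {1..n}" "j \<in> {1..n}" "i \<noteq> j"
      then have "comps i \<inter> comps j = {}" by (auto simp: comps_def)
      then show "(\<Union>cs\<in>comps i. fibre cs) \<inter> (\<Union>cs\<in>comps j. fibre cs) = {}"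
        by (auto simp: fibre_def)
    qed
  qed simp
  also have "\<dots> = (\<Sum>m=1..n. card {k. k dvd m} * ((2 * n - m - 1) choose (n - m)))"
    using inner by (intro sum.cong) auto
  finally show ?thesis .
qed

section \<open>Arc weights determined by the radii\<close>

definition wind :: "(int \<Rightarrow> real) \<Rightarrow> int \<Rightarrow> nat \<Rightarrow> real" where
  "wind u m j = (\<Sum>k<j. u (m + int k))"

lemma wind_0 [simp]: "wind u m 0 = 0"
  by (simp add: wind_def)

lemma wind_Suc: "wind u m (Suc j) = wind u m j + u (m + int j)"
  by (simp add: wind_def)

lemma wind_Suc_shift: "wind u m (Suc j) = u m + wind u (m + 1) j"
  unfolding wind_def by (subst sum.lessThan_Suc_shift) (simp add: algebra_simps)

lemma wind_add: "wind u m (i + j) = wind u m i + wind u (m + int i) j"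
  by (induction j) (simp_all add: wind_Suc add.assoc)

lemma wind_pos: "0 < j \<Longrightarrow> (\<And>k. 0 < u k) \<Longrightarrow> 0 < wind u m j"
  unfolding wind_def by (rule sum_pos) auto

text \<open>The share of a full turn around the puncture between the radii at \<open>k\<close> and
  \<open>k + 1\<close>; \<open>r\<close> is a free parameter here, fixed later by the sum over a
  turn.\<close>

definition step :: "(int \<Rightarrow> real) \<Rightarrow> real \<Rightarrow> int \<Rightarrow> real" where
  "step l r k = 1 / (r * l k * l (k + 1))"

text \<open>\<open>j = 0\<close> gives 0; once \<open>l\<close> is \<open>n\<close>-periodic and a
  turn sums to 1, \<open>j = n\<close> gives the loop, of weight \<open>r l(m)^2\<close>.\<close>

definition arc :: "(int \<Rightarrow> real) \<Rightarrow> real \<Rightarrow> int \<Rightarrow> nat \<Rightarrow> real" where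
  "arc l r m j = r * l m * l (m + int j) * wind (step l r) m j"

lemma arc_1:
  assumes "\<And>k. 0 < l k" "0 < r"
  shows "arc l r m (Suc 0) = 1"
  using assms(1)[of m] assms(1)[of "m + 1"] assms(2) by (simp add: arc_def wind_Suc step_def)

lemma arc_pos:
  assumes "\<And>k. 0 < l k" "0 < r" "0 < j"
  shows "0 < arc l r m j"
  using assms by (auto simp: arc_def step_def intro!: mult_pos_pos wind_pos)

text \<open>The core is \<open>(u + p)(p + v) = uv + (u + p + v)p\<close>. The hypotheses say that
  the arcs covering only the step \<open>u\<close> or only the step \<open>v\<close> have weight
  1.\<close>

lemma ptolemy:
  fixes A B C D p u v r :: real
  assumes "r * A * B * u = 1" "r * C * D * v = 1"
  shows "(r * A * C * (u + p)) * (r * B * D * (p + v)) =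
    1 + (r * A * D * (u + p + v)) * (r * B * C * p)"
proof -
  have "(r * A * C * (u + p)) * (r * B * D * (p + v)) =
      (r * A * B * u) * (r * C * D * v) + (r * A * D * (u + p + v)) * (r * B * C * p)"
    by (simp add: algebra_simps)
  then show ?thesis using assms by simp
qed

lemma step_mult:
  assumes "\<And>k. 0 < l k" "0 < r"
  shows "r * l k * l (k + 1) * step l r k = 1"
  using assms(1)[of k] assms(1)[of "k + 1"] assms(2) by (simp add: step_def)

text \<open>Ptolemy relation of the quadrilateral on \<open>m\<close>, \<open>m + 1\<close>,
  \<open>m + j + 1\<close>, \<open>m + j + 2\<close>, two of whose sides are boundary
  segments.\<close>

lemma arc_ptolemy:
  assumes "\<And>k. 0 < l k" "0 < r"
  shows "arc l r m (Suc j) * arc l r (m + 1) (Suc j) =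
    1 + arc l r m (Suc (Suc j)) * arc l r (m + 1) j"
proof -
  define p where "p = wind (step l r) (m + 1) j"
  have "arc l r m (Suc j) = r * l m * l (m + 1 + int j) * (step l r m + p)"
    by (simp add: arc_def wind_Suc_shift p_def add_ac)
  moreover have "arc l r (m + 1) (Suc j) =
      r * l (m + 1) * l (m + 1 + int j + 1) * (p + step l r (m + 1 + int j))"
    by (simp add: arc_def wind_Suc p_def add_ac)
  moreover have "arc l r m (Suc (Suc j)) =
      r * l m * l (m + 1 + int j + 1) * (step l r m + p + step l r (m + 1 + int j))"
  proof -
    have "wind (step l r) m (Suc (Suc j)) = step l r m + p + step l r (m + 1 + int j)"
      unfolding wind_Suc_shift[of _ m "Suc j"] by (simp add: wind_Suc p_def)
    then show ?thesis by (simp add: arc_def add_ac)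
  qed
  moreover have "arc l r (m + 1) j = r * l (m + 1) * l (m + 1 + int j) * p"
    by (simp add: arc_def p_def)
  ultimately show ?thesis
    using ptolemy[OF step_mult[of l r m] step_mult[of l r "m + 1 + int j"]] assms by simp
qed

text \<open>Reduction of order: since \<open>l\<close> solves the recurrence, so does
  \<open>l\<close> times the partial sums of \<open>1 / (l(k) l(k + 1))\<close>.\<close>

lemma arc_Suc_Suc:
  assumes "\<And>k. 0 < l k" "0 < r"
    and "l k + l (k + 2) = q * l (k + 1)" "k = m + int j"
  shows "arc l r m (Suc (Suc j)) = q * arc l r m (Suc j) - arc l r m j"
proof -
  define p where "p = wind (step l r) m j"
  note pos = assms(1)[of k] assms(1)[of "k + 1"] assms(1)[of "k + 2"] assms(2)
  have u: "r * l k * l (k + 1) * step l r k = 1"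
    "r * l (k + 1) * l (k + 2) * step l r (k + 1) = 1"
    using step_mult[of l r k, OF assms(1,2)] step_mult[of l r "k + 1", OF assms(1,2)] by (simp_all add: add.assoc)
  \<comment> \<open>After multiplication by \<open>r * l k\<close> both sides are
    \<open>l k + l (k + 2)\<close>.\<close>
  have "l (k + 1) * (l (k + 2) * (step l r k + step l r (k + 1))) =
      l (k + 1) * (q * l (k + 1) * step l r k)"
  proof -
    have "r * l k * (l (k + 1) * (l (k + 2) * (step l r k + step l r (k + 1)))) =
        l (k + 2) * (r * l k * l (k + 1) * step l r k)
        + l k * (r * l (k + 1) * l (k + 2) * step l r (k + 1))"
      by (simp add: algebra_simps)
    also have "\<dots> = (l k + l (k + 2)) * (r * l k * l (k + 1) * step l r k)"
      unfolding u by simp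
    also have "\<dots> = r * l k * (l (k + 1) * (q * l (k + 1) * step l r k))"
      unfolding assms(3) by (simp add: algebra_simps)
    finally show ?thesis using pos by simp
  qed
  then have e: "l (k + 2) * (step l r k + step l r (k + 1)) = q * l (k + 1) * step l r k"
    using pos by simp
  have "arc l r m (Suc (Suc j)) = r * l m * l (k + 2) * (p + step l r k + step l r (k + 1))"
    by (simp add: arc_def wind_Suc p_def assms(4) add_ac)
  also have "\<dots> = r * l m * (p * (q * l (k + 1) - l k) + l (k + 2) * (step l r k + step l r (k + 1)))"
    unfolding assms(3)[symmetric] by (simp add: algebra_simps)
  also have "\<dots> = q * (r * l m * l (k + 1) * (p + step l r k)) - r * l m * l k * p"
    unfolding e by (simp add: algebra_simps)
  finally show ?thesis
    by (simp add: arc_def wind_Suc p_def assms(4) add_ac)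
qed

lemma arc_Ints:
  assumes "\<And>k. 0 < l k" "0 < r" and "\<And>k. \<exists>q\<in>\<int>. l k + l (k + 2) = q * l (k + 1)"
  shows "arc l r m j \<in> \<int>"
proof (induction j rule: induct_nat_012)
  case 0
  then show ?case by (simp add: arc_def)
next
  case 1
  then show ?case using arc_1[of l r m, OF assms(1,2)] by simp
next
  case (ge2 j)
  obtain q where "q \<in> \<int>" "l (m + int j) + l (m + int j + 2) = q * l (m + int j + 1)"
    using assms(3) by blast
  then show ?case
    using arc_Suc_Suc[of l r "m + int j" q m j] ge2 assms(1,2) by simp
qed

text \<open>Periodicity and the sum of a turn are conclusions, so arcs are first written by what
  they omit: with \<open>s = n - j\<close>, the arc of span \<open>j\<close> involves
  \<open>S m s\<close>, one minus the \<open>s\<close> steps before \<open>m\<close>. The boundary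
  weights \<open>x m 1 = 1\<close> then force \<open>S\<close> to vanish after \<open>n\<close>
  steps, so that a turn sums to 1, and force \<open>l\<close> to be periodic.\<close>

lemma arc_unique:
  fixes l :: "int \<Rightarrow> real" and x :: "int \<Rightarrow> nat \<Rightarrow> real"
  assumes l: "\<And>k. 0 < l k" and r: "0 < r" and n: "2 \<le> n"
    and pos: "\<And>m j. j \<in> {1..n} \<Longrightarrow> 0 < x m j"
    and x1: "\<And>m. x m 1 = 1"
    and xn: "\<And>m. x m n = r * l m * l m"
    and xn1: "\<And>m. r * l m * l (m + 1) = 1 + x (m + 1) (n - 1)"
    and rel: "\<And>m j. j \<in> {2..n - 1} \<Longrightarrow> x m j * x (m + 1) j = 1 + x m (j + 1) * x (m + 1) (j - 1)"
  shows "wind (step l r) m n = 1" "l (m + int n) = l m"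
    "j \<in> {1..n} \<Longrightarrow> x m j = arc l r m j"
proof -
  define u where "u = step l r"
  define S where "S = (\<lambda>m s. 1 - wind u (m - int s) s)"
  have um: "r * l k * l (k + 1) * u k = 1" for k
    using step_mult[of l r k, OF l r] by (simp add: u_def)
  have S_Suc: "S m s = S m (Suc s) + u (m - int (Suc s))" for m s
    by (simp add: S_def wind_Suc_shift)
  have S_Suc': "S m s = S (m + 1) (Suc s) + u m" for m s
    by (simp add: S_def wind_Suc)
  \<comment> \<open>This is \<open>ptolemy\<close> again: the omitted stretch grows at either end,
    by the step \<open>v\<close> or by \<open>u m\<close>.\<close>
  have ptol: "(r * l m * l (m - int (Suc s)) * S m (Suc s)) * (r * l (m + 1) * l (m - int s) * S (m + 1) (Suc s))
      = 1 + (r * l m * l (m - int s) * S m s) * (r * l (m + 1) * l (m - int (Suc s)) * S (m + 1) (Suc (Suc s)))"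
    for m s
  proof -
    define p where "p = S (m + 1) (Suc (Suc s))"
    define v where "v = u (m - int (Suc s))"
    have 1: "S (m + 1) (Suc s) = v + p" 
      using S_Suc[of "m + 1" "Suc s"] by (simp add: p_def v_def algebra_simps)
    have 2: "S m (Suc s) = p + u m" using S_Suc'[of m "Suc s"] by (simp add: p_def)
    have 3: "S m s = v + p + u m" using S_Suc[of m s] 2 by (simp add: v_def algebra_simps)
    have "r * l (m - int (Suc s)) * l (m - int s) * v = 1"
      using um[of "m - int (Suc s)"] by (simp add: v_def algebra_simps)
    from ptolemy[OF um[of m] this, of p] show ?thesis
      unfolding 1 2 3 p_def[symmetric] by (simp only: ac_simps)
  qed
  \<comment> \<open>The relations determine the arcs from \<open>m\<close> by increasing \<open>s\<close>, starting with the loop at \<open>m\<close>.\<close>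
  have x_eq: "x m (n - s) = r * l m * l (m - int s) * S m s" if "s < n" for m s
    using that
  proof (induction s arbitrary: m rule: induct_nat_012)
    case 0
    then show ?case by (simp add: xn S_def)
  next
    case 1
    have "r * l (m - 1) * l m = 1 + x m (n - 1)" using xn1[of "m - 1"] by simp
    moreover have "r * l m * l (m - 1) * (1 - u (m - 1)) = r * l (m - 1) * l m - 1"
      using um[of "m - 1"] by (simp add: algebra_simps)
    ultimately show ?case by (simp add: S_def wind_Suc)
  next
    case (ge2 s)
    define k where "k = m - 1"
    have m: "m = k + 1" by (simp add: k_def)
    have e: "m - int (Suc (Suc s)) = k - int (Suc s)" "m - int (Suc s) = k - int s"
      by (simp_all add: k_def)
    have j: "n - Suc s \<in> {2..n - 1}" "n - Suc s + 1 = n - s" "n - Suc s - 1 = n - Suc (Suc s)"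
      using ge2.prems by auto
    have A: "x k (n - s) = r * l k * l (k - int s) * S k s"
      "x k (n - Suc s) = r * l k * l (k - int (Suc s)) * S k (Suc s)"
      "x m (n - Suc s) = r * l m * l (m - int (Suc s)) * S m (Suc s)"
      using ge2 by simp_all
    have "0 < x k (n - s)" using ge2.prems by (intro pos) auto
    moreover have "x k (n - s) * x m (n - Suc (Suc s)) =
        x k (n - s) * (r * l m * l (m - int (Suc (Suc s))) * S m (Suc (Suc s)))"
      using rel[OF j(1), of k] ptol[of k s] unfolding j(2,3) m[symmetric] A e
      by linarith
    ultimately show ?case by simp
  qed
  have per: "wind u (m + 1 - int n) n = 1 \<and> l (m + 1 - int n) = l (m + 1)" for m
  proof -
    obtain s where s: "n = Suc (Suc s)" using n by (metis Suc_le_D numeral_2_eq_2 Suc_le_mono)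
    have A: "1 = r * l m * l (m - int (Suc s)) * S m (Suc s)"
      "1 = r * l (m + 1) * l (m + 1 - int (Suc s)) * S (m + 1) (Suc s)"
      "x m 2 = r * l m * l (m - int s) * S m s"
      using x_eq[of "Suc s" m] x_eq[of "Suc s" "m + 1"] x_eq[of s m] x1 by (simp_all add: s numeral_2_eq_2)
    have "0 < x m 2" using n by (intro pos) auto
    \<comment> \<open>At \<open>s = n - 2\<close> both factors on the left of \<open>ptol\<close>
      are boundary weights 1, so the product on the right vanishes.\<close>
    moreover have "x m 2 * (r * l (m + 1) * l (m - int (Suc s)) * S (m + 1) (Suc (Suc s))) = 0"
      using ptol[of m s] A by simp
    ultimately have S0: "S (m + 1) (Suc (Suc s)) = 0"
      using l[of "m + 1"] l[of "m - int (Suc s)"] r by simp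
    then have "S m (Suc s) = u m" using S_Suc'[of m "Suc s"] by simp
    then have "r * l m * l (m - int (Suc s)) * u m = r * l m * l (m + 1) * u m"
      using A(1) um[of m] by simp
    then have "(r * l m * u m) * l (m - int (Suc s)) = (r * l m * u m) * l (m + 1)"
      by (simp only: ac_simps)
    moreover have "r * l m * u m \<noteq> 0"
      using l[of m] l[of "m + 1"] r by (simp add: u_def step_def)
    ultimately have "l (m - int (Suc s)) = l (m + 1)" by (metis mult_left_cancel)
    then show ?thesis using S0 by (simp add: S_def s algebra_simps)
  qed
  have w: "wind u k n = 1" "l k = l (k + int n)" for k
    using per[of "k + int n - 1"] by simp_all
  then show "wind (step l r) m n = 1" "l (m + int n) = l m" by (simp_all add: u_def)
  show "x m j = arc l r m j" if j: "j \<in> {1..n}"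
  proof -
    define s where "s = n - j"
    have s: "s < n" "n - s = j" "n = s + j" using j by (auto simp: s_def)
    have "S m s = wind u m j"
      using w(1)[of "m - int s"] by (simp add: S_def s(3) wind_add)
    moreover have "l (m - int s) = l (m + int j)"
      using w(2)[of "m - int s"] s by simp
    ultimately show ?thesis
      using x_eq[OF s(1), of m] s(2) by (simp add: arc_def u_def)
  qed
qed

section \<open>Change of orientation\<close>

definition nbrs :: "nat \<Rightarrow> nat \<Rightarrow> nat set" where
  "nbrs n j = {i \<in> {1..n}. edge_D n i j \<or> edge_D n j i}"

text \<open>The frieze relations for the orientation in which every edge points to its larger end.\<close>

definition D_system :: "nat \<Rightarrow> (nat \<Rightarrow> int \<Rightarrow> int) \<Rightarrow> bool" where
  "D_system n b \<longleftrightarrow> (\<forall>j\<in>{1..n}. \<forall>m.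
     b j m * b j (m + 1) = 1 + (\<Prod>i\<in>nbrs n j. b i (m + of_bool (edge_D n i j))))"

text \<open>Acyclicity gives each edge one direction only, and the Cartan entries at neighbours are
  -1, so the two products merge. The second argument of \<open>f\<close> is the shift in
  \<open>m\<close>: 1 for arrows into \<open>j\<close>, 0 for arrows out of it.\<close>

lemma frieze_product:
  assumes E: "acyclic_orientation n (cartan_D n) E" and j: "j \<in> {1..n}"
  shows "(\<Prod>i\<in>{i. (j, i) \<in> E}. f i 0 ^ nat \<bar>cartan_D n i j\<bar>) *
      (\<Prod>i\<in>{i. (i, j) \<in> E}. f i 1 ^ nat \<bar>cartan_D n i j\<bar>) =
    (\<Prod>i\<in>nbrs n j. f i (of_bool ((i, j) \<in> E) :: int) :: int)"
proof -
  have sub: "E \<subseteq> {1..n} \<times> {1..n}" and "acyclic E"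
    and adj: "\<And>i. i \<in> {1..n} \<Longrightarrow> i \<noteq> j \<Longrightarrow> (i, j) \<in> E \<or> (j, i) \<in> E \<longleftrightarrow> cartan_D n i j \<noteq> 0"
    using E j by (auto simp: acyclic_orientation_def)
  have asym: "(j, i) \<in> E \<Longrightarrow> (i, j) \<notin> E" for i
    using \<open>acyclic E\<close> by (meson acyclic_def trancl.r_into_trancl trancl.trancl_into_trancl)
  then have "(j, j) \<notin> E" by blast
  have irr: "\<not> edge_D n i i" for i by (auto simp: edge_D_def)
  have un: "nbrs n j = {i. (j, i) \<in> E} \<union> {i. (i, j) \<in> E}"
  proof (intro set_eqI iffI)
    fix i assume "i \<in> nbrs n j"
    then show "i \<in> {i. (j, i) \<in> E} \<union> {i. (i, j) \<in> E}"
      using adj[of i] irr by (auto simp: nbrs_def cartan_D_def)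
  next
    fix i assume i: "i \<in> {i. (j, i) \<in> E} \<union> {i. (i, j) \<in> E}"
    then have "i \<noteq> j" "i \<in> {1..n}" using sub \<open>(j, j) \<notin> E\<close> by auto
    with i show "i \<in> nbrs n j"
      using adj[of i] by (auto simp: nbrs_def cartan_D_def split: if_splits)
  qed
  have fin: "finite (nbrs n j)" by (simp add: nbrs_def)
  have C: "nat \<bar>cartan_D n i j\<bar> = 1" if "i \<in> nbrs n j" for i
    using that irr by (auto simp: nbrs_def cartan_D_def)
  have "(\<Prod>i\<in>nbrs n j. f i (of_bool ((i, j) \<in> E))) =
      (\<Prod>i\<in>{i. (j, i) \<in> E}. f i (of_bool ((i, j) \<in> E))) *
      (\<Prod>i\<in>{i. (i, j) \<in> E}. f i (of_bool ((i, j) \<in> E)))"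
    unfolding un using fin asym by (intro prod.union_disjoint) (auto simp: un)
  also have "(\<Prod>i\<in>{i. (j, i) \<in> E}. f i (of_bool ((i, j) \<in> E))) =
      (\<Prod>i\<in>{i. (j, i) \<in> E}. f i 0 ^ nat \<bar>cartan_D n i j\<bar>)"
    using asym C un by (intro prod.cong) auto
  also have "(\<Prod>i\<in>{i. (i, j) \<in> E}. f i (of_bool ((i, j) \<in> E))) =
      (\<Prod>i\<in>{i. (i, j) \<in> E}. f i 1 ^ nat \<bar>cartan_D n i j\<bar>)"
    using C un by (intro prod.cong) auto
  finally show ?thesis by simp
qed

text \<open>The diagram is a tree, so shifting each row by its height turns any orientation into the standard one.\<close>

lemma height_exists:
  "\<exists>h :: nat \<Rightarrow> int. \<forall>i j. edge_D n i j \<longrightarrow> h j = h i - of_bool ((j, i) \<in> E)"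
proof -
  \<comment> \<open>\<open>g\<close> follows the path upwards from 0; the vertex \<open>n\<close> is
    attached to \<open>n - 2\<close> and gets its own value in \<open>h\<close>.\<close>
  define g :: "nat \<Rightarrow> int" where
    "g = rec_nat 0 (\<lambda>j x. x - of_bool ((Suc j, j) \<in> E))"
  define h where "h j = (if j = n then g (n - 2) - of_bool ((n, n - 2) \<in> E) else g j)" for j
  have "h j = h i - of_bool ((j, i) \<in> E)" if "edge_D n i j" for i j
    using that by (auto simp: edge_D_def h_def g_def)
  then show ?thesis by blast
qed

text \<open>The bijection replaces each row by \<open>a j (m - h j)\<close>. By the choice of
  \<open>h\<close>, the delay between neighbouring rows prescribed by \<open>E\<close> turns into
  that of the standard orientation; this is the fact \<open>shift\<close>.\<close>

lemma card_friezes_eq: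
  assumes E: "acyclic_orientation n (cartan_D n) E"
  shows "card (friezes n (cartan_D n) E) =
    card {b \<in> {1..n} \<rightarrow>\<^sub>E (UNIV \<rightarrow> {0<..}). D_system n b}" (is "card ?A = card ?B")
proof -
  obtain h :: "nat \<Rightarrow> int" where h: "\<And>i j. edge_D n i j \<Longrightarrow> h j = h i - of_bool ((j, i) \<in> E)"
    using height_exists[of n E] by blast
  have flip: "of_bool ((i, j) \<in> E) + of_bool ((j, i) \<in> E) = (1::int)"
    if "i \<in> nbrs n j" "j \<in> {1..n}" for i j
  proof -
    have "i \<noteq> j" using that by (auto simp: nbrs_def edge_D_def)
    then have "(i, j) \<in> E \<or> (j, i) \<in> E"
      using E that by (auto simp: acyclic_orientation_def nbrs_def cartan_D_def)
    moreover have "\<not> ((i, j) \<in> E \<and> (j, i) \<in> E)"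
      using E by (meson acyclic_orientation_def acyclic_def trancl.r_into_trancl trancl.trancl_into_trancl)
    ultimately show ?thesis by auto
  qed
  have shift: "of_bool ((i, j) \<in> E) - h j = of_bool (edge_D n i j) - h i"
    if "i \<in> nbrs n j" "j \<in> {1..n}" for i j
  proof (cases "edge_D n i j")
    case True
    then show ?thesis using h[of i j] flip[OF that] by simp
  next
    case False
    then have "edge_D n j i" using that by (simp add: nbrs_def)
    then show ?thesis using h[of j i] False by simp
  qed
  have iff: "a \<in> ?A \<longleftrightarrow> a \<in> {1..n} \<rightarrow>\<^sub>E (UNIV \<rightarrow> {0<..}) \<and> D_system n (\<lambda>j m. a j (m - h j))" for a
  proof -
    have "(\<forall>m. a j m * a j (m + 1) = 1 + (\<Prod>i\<in>{i. (j, i) \<in> E}. a i m ^ nat \<bar>cartan_D n i j\<bar>)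
              * (\<Prod>i\<in>{i. (i, j) \<in> E}. a i (m + 1) ^ nat \<bar>cartan_D n i j\<bar>)) \<longleftrightarrow>
        (\<forall>m. a j (m - h j) * a j (m + 1 - h j) =
          1 + (\<Prod>i\<in>nbrs n j. a i (m + of_bool (edge_D n i j) - h i)))" (is "(\<forall>m. ?P m) \<longleftrightarrow> (\<forall>m. ?Q m)")
      if j: "j \<in> {1..n}" for j
    proof -
      have eq: "?P (m - h j) \<longleftrightarrow> ?Q m" for m
      proof -
        have "(\<Prod>i\<in>nbrs n j. a i (m - h j + of_bool ((i, j) \<in> E))) =
            (\<Prod>i\<in>nbrs n j. a i (m + of_bool (edge_D n i j) - h i))"
        proof (rule prod.cong)
          fix i assume "i \<in> nbrs n j"
          from shift[OF this j] have "m - h j + of_bool ((i, j) \<in> E) = m + of_bool (edge_D n i j) - h i"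
            by linarith
          then show "a i (m - h j + of_bool ((i, j) \<in> E)) = a i (m + of_bool (edge_D n i j) - h i)"
            by (rule arg_cong)
        qed simp
        then show ?thesis
          using frieze_product[OF E j, of "\<lambda>i d. a i (m - h j + d)"] by (simp add: algebra_simps)
      qed
      show ?thesis
      proof (intro iffI allI)
        fix m assume "\<forall>m. ?P m"
        then have "?P (m - h j)" by (rule spec)
        then show "?Q m" by (simp only: eq)
      next
        fix m assume "\<forall>m. ?Q m"
        then have "?Q (m + h j)" by (rule spec)
        then have "?P (m + h j - h j)" by (simp only: eq)
        then show "?P m" by (simp only: add_diff_cancel)
      qed
    qed
    then show ?thesis by (auto simp: friezes_def D_system_def)
  qed
  define sh where "sh k a = (\<lambda>j\<in>{1..n}. \<lambda>m. a j (m + k j))"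
    for k :: "nat \<Rightarrow> int" and a :: "nat \<Rightarrow> int \<Rightarrow> int"
  have sys: "D_system n b \<longleftrightarrow> D_system n c" if "\<And>j. j \<in> {1..n} \<Longrightarrow> b j = c j" for b c
  proof -
    have "(\<Prod>i\<in>nbrs n j. b i (m + of_bool (edge_D n i j))) = (\<Prod>i\<in>nbrs n j. c i (m + of_bool (edge_D n i j)))" for j m
      using that by (intro prod.cong) (auto simp: nbrs_def)
    then show ?thesis using that by (simp add: D_system_def)
  qed
  have inv: "sh k (sh (\<lambda>j. - k j) a) = a" "sh (\<lambda>j. - k j) (sh k a) = a"
    if "a \<in> {1..n} \<rightarrow>\<^sub>E (UNIV \<rightarrow> {0<..})" for k a
    using that by (auto simp: sh_def fun_eq_iff PiE_def extensional_def)
  have ext: "sh k a \<in> {1..n} \<rightarrow>\<^sub>E (UNIV \<rightarrow> {0<..})" if "a \<in> {1..n} \<rightarrow>\<^sub>E (UNIV \<rightarrow> {0<..})" for k a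
    using that by (auto simp: sh_def PiE_iff Pi_iff)
  have "bij_betw (sh (\<lambda>j. - h j)) ?A ?B"
  proof (rule bij_betwI[where g = "sh h"])
    show "sh (\<lambda>j. - h j) \<in> ?A \<rightarrow> ?B"
    proof
      fix a assume a: "a \<in> ?A"
      have "D_system n (sh (\<lambda>j. - h j) a) \<longleftrightarrow> D_system n (\<lambda>j m. a j (m - h j))"
        by (rule sys) (simp add: sh_def)
      then show "sh (\<lambda>j. - h j) a \<in> ?B" using a ext by (auto simp: iff)
    qed
    show "sh h \<in> ?B \<rightarrow> ?A"
    proof
      fix b assume b: "b \<in> ?B"
      have "D_system n (\<lambda>j m. sh h b j (m - h j)) \<longleftrightarrow> D_system n b"
        by (rule sys) (simp add: sh_def)
      then show "sh h b \<in> ?A" using b ext by (auto simp: iff)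
    qed
  qed (use inv in \<open>auto simp: iff\<close>)
  then show ?thesis by (rule bij_betw_same_card)
qed

section \<open>The relations of type D as relations between arcs\<close>

text \<open>
  The weight of the arc from \<open>m\<close> to \<open>m + j\<close>: a boundary segment for \<open>j = 1\<close>, and for \<open>j = n\<close> the loop
  around the puncture, whose weight is the product of the two radii at \<open>m\<close>.
\<close>

definition chord :: "nat \<Rightarrow> (nat \<Rightarrow> int \<Rightarrow> int) \<Rightarrow> int \<Rightarrow> nat \<Rightarrow> int" where
  "chord n b m j = (if j = 1 then 1 else if j = n then b (n - 1) m * b n m else b (j - 1) m)"

text \<open>Row \<open>j\<close> holds the arcs of span \<open>j + 1\<close>. The neighbour
  \<open>j - 1\<close>, or for \<open>j = 1\<close> a boundary segment, gives span \<open>j\<close>;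
  the larger neighbours give span \<open>j + 2\<close>, where for \<open>j = n - 2\<close> the rows
  \<open>n - 1\<close> and \<open>n\<close> multiply to the loop.\<close>

lemma prod_nbrs_inner:
  assumes j: "1 \<le> j" "j + 2 \<le> n"
  shows "(\<Prod>i\<in>nbrs n j. b i (m + of_bool (edge_D n i j))) = chord n b m (j + 2) * chord n b (m + 1) j"
proof -
  define lo where "lo = {j - 1} - {0}"
  have lo: "(\<Prod>i\<in>lo. b i (m + of_bool (edge_D n i j))) = chord n b (m + 1) j"
  proof (cases "j = 1")
    case False
    then show ?thesis using j by (auto simp: lo_def chord_def edge_D_def)
  qed (simp add: lo_def chord_def)
  show ?thesis
  proof (cases "j + 2 = n")
    case True
    then have nb: "nbrs n j = lo \<union> {j + 1, n}"
      using j by (auto simp: nbrs_def edge_D_def lo_def)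
    have "(\<Prod>i\<in>{j + 1, n}. b i (m + of_bool (edge_D n i j))) = chord n b m (j + 2)"
      using True j by (auto simp: chord_def edge_D_def)
    moreover have "lo \<inter> {j + 1, n} = {}" using j by (auto simp: lo_def)
    moreover have "finite lo" by (simp add: lo_def)
    ultimately show ?thesis unfolding nb using lo by (simp only: prod.union_disjoint finite.intros mult.commute)
  next
    case False
    then have nb: "nbrs n j = lo \<union> {j + 1}"
      using j by (auto simp: nbrs_def edge_D_def lo_def)
    have "(\<Prod>i\<in>{j + 1}. b i (m + of_bool (edge_D n i j))) = chord n b m (j + 2)"
      using False j by (auto simp: chord_def edge_D_def)
    moreover have "lo \<inter> {j + 1} = {}" using j by (auto simp: lo_def)
    moreover have "finite lo" by (simp add: lo_def)
    ultimately show ?thesis unfolding nb using lo by (simp only: prod.union_disjoint finite.intros mult.commute)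
  qed
qed

text \<open>Both ends of the fork hang from \<open>n - 2\<close>, whose row holds the arcs of span
  \<open>n - 1\<close>. For \<open>n = 2\<close> there is no edge, and the empty product matches the
  boundary weight at span 1.\<close>

lemma prod_nbrs_end:
  assumes n: "2 \<le> n" and j: "j = n - 1 \<or> j = n"
  shows "(\<Prod>i\<in>nbrs n j. b i (m + of_bool (edge_D n i j))) = chord n b (m + 1) (n - 1)"
proof (cases "n = 2")
  case True
  then have "nbrs n j = {}" using j by (auto simp: nbrs_def edge_D_def)
  then show ?thesis using True by (simp add: chord_def)
next
  case False
  then have "nbrs n j = {n - 2}" "edge_D n (n - 2) j"
    using j n by (auto simp: nbrs_def edge_D_def)
  moreover have "n - 1 \<noteq> 1" "n - 1 \<noteq> n" "n - 1 - 1 = n - 2" using False n by simp_all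
  ultimately show ?thesis unfolding chord_def by simp
qed

lemma D_system_iff:
  assumes n: "2 \<le> n"
  shows "D_system n b \<longleftrightarrow>
    (\<forall>m. \<forall>j\<in>{2..n - 1}. chord n b m j * chord n b (m + 1) j =
        1 + chord n b m (j + 1) * chord n b (m + 1) (j - 1)) \<and>
    (\<forall>m. b (n - 1) m * b (n - 1) (m + 1) = 1 + chord n b (m + 1) (n - 1)) \<and>
    (\<forall>m. b n m * b n (m + 1) = 1 + chord n b (m + 1) (n - 1))" (is "_ \<longleftrightarrow> ?R \<and> ?S \<and> ?T")
proof -
  define P where "P j \<longleftrightarrow> (\<forall>m. b j m * b j (m + 1) = 1 + (\<Prod>i\<in>nbrs n j. b i (m + of_bool (edge_D n i j))))" for j
  have "{1..n} = {1..n - 2} \<union> {n - 1, n}" using n by auto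
  then have "D_system n b \<longleftrightarrow> (\<forall>j\<in>{1..n - 2}. P j) \<and> P (n - 1) \<and> P n"
    by (auto simp: D_system_def P_def)
  moreover have "P (n - 1) \<longleftrightarrow> ?S" "P n \<longleftrightarrow> ?T"
    using prod_nbrs_end[OF n] by (simp_all add: P_def)
  moreover have "(\<forall>j\<in>{1..n - 2}. P j) \<longleftrightarrow> ?R"
  proof -
    have "P j \<longleftrightarrow> (\<forall>m. chord n b m (Suc j) * chord n b (m + 1) (Suc j) =
        1 + chord n b m (Suc j + 1) * chord n b (m + 1) (Suc j - 1))" if "j \<in> {1..n - 2}" for j
    proof -
      have "1 \<le> j" "j + 2 \<le> n" using that by auto
      moreover have "chord n b m (Suc j) = b j m" for m
        using that by (auto simp: chord_def)
      ultimately show ?thesis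
        using prod_nbrs_inner[of j n b] by (simp add: P_def)
    qed
    moreover have "{2..n - 1} = Suc ` {1..n - 2}"
    proof -
      obtain k where "n = Suc (Suc k)" using n by (metis Suc_le_D numeral_2_eq_2 Suc_le_mono)
      then show ?thesis by (simp add: image_Suc_atLeastAtMost numeral_2_eq_2)
    qed
    ultimately show ?thesis by (auto simp del: image_Suc_atLeastAtMost)
  qed
  ultimately show ?thesis by simp
qed

section \<open>Friezes and radii\<close>

definition radial :: "nat \<Rightarrow> (int \<Rightarrow> int) \<Rightarrow> bool" where
  "radial n l \<longleftrightarrow> (\<forall>m. 0 < l m) \<and> (\<forall>m. l (m + int n) = l m) \<and>
     (\<forall>m. l m dvd l (m - 1) + l (m + 1)) \<and>
     (\<forall>m. wind (step (\<lambda>k. real_of_int (l k)) 1) 0 n * real_of_int (l m) \<in> \<int>)"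

definition unroll :: "nat list \<Rightarrow> int \<Rightarrow> int" where
  "unroll xs m = int (xs ! nat (m mod int (length xs)))"

lemma unroll_nth: "i < length xs \<Longrightarrow> unroll xs (int i) = int (xs ! i)"
  by (simp add: unroll_def)

lemma unroll_mod: "unroll xs (m mod int (length xs) + d) = unroll xs (m + d)"
  by (simp add: unroll_def mod_simps)

lemma unroll_succ:
  assumes "i < length xs"
  shows "unroll xs (int i + 1) = int (cyc_succ xs i)"
proof -
  have "(int i + 1) mod int (length xs) = int (Suc i mod length xs)"
    by (simp add: zmod_int add.commute)
  then show ?thesis by (simp add: unroll_def cyc_succ_def)
qed

lemma unroll_pred:
  assumes "i < length xs"
  shows "unroll xs (int i - 1) = int (cyc_pred xs i)"
proof -
  have "int (i + (length xs - 1)) = (int i - 1) + int (length xs)" using assms by simp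
  then have "(int i - 1) mod int (length xs) = int ((i + (length xs - 1)) mod length xs)"
    by (simp only: zmod_int mod_add_self2)
  then show ?thesis by (simp add: unroll_def cyc_pred_def)
qed

lemma radial_unroll_iff:
  assumes "length xs = n" "0 < n"
  shows "radial n (unroll xs) \<longleftrightarrow> xs \<in> radii n"
proof -
  \<comment> \<open>The forms \<open>m + - 1\<close> and \<open>m + 0\<close> let
    \<open>unroll_mod\<close> rewrite all three arguments alike, reducing \<open>m\<close> to its
    remainder modulo \<open>n\<close>.\<close>
  have all: "(\<forall>m. P (unroll xs (m + - 1)) (unroll xs (m + 0)) (unroll xs (m + 1))) \<longleftrightarrow>
      (\<forall>i<n. P (int (cyc_pred xs i)) (int (xs ! i)) (int (cyc_succ xs i)))" for P
  proof (intro iffI allI impI)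
    fix i assume "\<forall>m. P (unroll xs (m + - 1)) (unroll xs (m + 0)) (unroll xs (m + 1))" "i < n"
    then have "P (unroll xs (int i + - 1)) (unroll xs (int i + 0)) (unroll xs (int i + 1))" by blast
    then show "P (int (cyc_pred xs i)) (int (xs ! i)) (int (cyc_succ xs i))"
      using \<open>i < n\<close> assms by (simp add: unroll_pred unroll_nth unroll_succ)
  next
    fix m assume H: "\<forall>i<n. P (int (cyc_pred xs i)) (int (xs ! i)) (int (cyc_succ xs i))"
    define i where "i = nat (m mod int n)"
    have i: "i < n" "int i = m mod int (length xs)"
      using assms by (simp_all add: i_def nat_less_iff)
    have "P (unroll xs (int i + - 1)) (unroll xs (int i + 0)) (unroll xs (int i + 1))"
      using H i(1) assms by (simp add: unroll_pred unroll_nth unroll_succ)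
    then show "P (unroll xs (m + - 1)) (unroll xs (m + 0)) (unroll xs (m + 1))"
      unfolding i(2) unroll_mod .
  qed
  have w: "wind (step (\<lambda>k. real_of_int (unroll xs k)) 1) 0 n = recip_sum xs"
    unfolding wind_def recip_sum_def using assms
    by (intro sum.cong) (auto simp: step_def unroll_nth unroll_succ)
  have set: "(\<forall>x\<in>set xs. Q x) \<longleftrightarrow> (\<forall>i<n. Q (xs ! i))" for Q
    using assms by (simp add: all_set_conv_all_nth)
  have "unroll xs (m + int n) = unroll xs m" for m
    using assms by (simp add: unroll_def)
  moreover have "(\<forall>m. 0 < unroll xs m) \<longleftrightarrow> (\<forall>x\<in>set xs. 0 < x)"
    using all[of "\<lambda>a b c. 0 < b"] by (simp add: set)
  moreover have "(\<forall>m. unroll xs m dvd unroll xs (m - 1) + unroll xs (m + 1)) \<longleftrightarrow>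
      (\<forall>i<n. xs ! i dvd cyc_pred xs i + cyc_succ xs i)"
    using all[of "\<lambda>a b c. b dvd a + c"] by (simp flip: of_nat_add)
  moreover have "(\<forall>m. recip_sum xs * real_of_int (unroll xs m) \<in> \<int>) \<longleftrightarrow>
      (\<forall>x\<in>set xs. recip_sum xs * real x \<in> \<int>)"
    using all[of "\<lambda>a b c. recip_sum xs * real_of_int b \<in> \<int>"] by (simp add: set)
  ultimately show ?thesis
    using assms by (simp add: radial_def radii_def w)
qed

lemma periodic_mult:
  fixes f :: "int \<Rightarrow> 'a"
  assumes "\<And>m. f (m + p) = f m"
  shows "f (m + k * p) = f m"
proof (induction k rule: int_induct[of _ 0])
  case (step1 i)
  then show ?case using assms[of "m + i * p"] by (simp add: algebra_simps)
next
  case (step2 i)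
  then show ?case using assms[of "m + (i - 1) * p"] by (simp add: algebra_simps)
qed simp

lemma card_radial:
  assumes "0 < n"
  shows "card {l. radial n l} = card (radii n)"
proof -
  have "bij_betw unroll (radii n) {l. radial n l}"
    unfolding bij_betw_def
  proof
    show "inj_on unroll (radii n)"
    proof (rule inj_onI)
      fix xs ys assume "xs \<in> radii n" "ys \<in> radii n" and eq: "unroll xs = unroll ys"
      then have len: "length xs = n" "length ys = n" by (auto simp: radii_def)
      have "xs ! i = ys ! i" if "i < n" for i
        using unroll_nth[of i xs] unroll_nth[of i ys] eq len that by simp
      then show "xs = ys" using len by (simp add: nth_equalityI)
    qed
    show "unroll ` radii n = {l. radial n l}"
    proof
      show "unroll ` radii n \<subseteq> {l. radial n l}"
        using radial_unroll_iff assms by (auto simp: radii_def)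
      show "{l. radial n l} \<subseteq> unroll ` radii n"
      proof
        fix l assume "l \<in> {l. radial n l}"
        then have l: "radial n l" by simp
        define xs where "xs = map (\<lambda>i. nat (l (int i))) [0..<n]"
        have "unroll xs m = l m" for m
        proof -
          have "nat (m mod int n) < n" "0 \<le> m mod int n" using assms by (simp_all add: nat_less_iff)
          moreover have "0 \<le> l k" for k using l by (simp add: radial_def less_imp_le)
          ultimately have "unroll xs m = l (m mod int n)" by (simp add: unroll_def xs_def)
          also have "\<dots> = l (m mod int n + m div int n * int n)"
            using l by (subst periodic_mult) (simp_all add: radial_def)
          finally show ?thesis by simp
        qed
        then have "unroll xs = l" by blast
        moreover have "length xs = n" by (simp add: xs_def)
        ultimately show "l \<in> unroll ` radii n"
          using radial_unroll_iff[of xs n] l assms by blast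
      qed
    qed
  qed
  then show ?thesis using bij_betw_same_card by metis
qed

section \<open>From friezes to radial sequences and back\<close>

lemma wind_periodic:
  assumes "\<And>m. u (m + int n) = u m"
  shows "wind u m n = wind u 0 n"
proof -
  have s: "wind u (k + 1) n = wind u k n" for k
    using wind_Suc[of u k n] wind_Suc_shift[of u k n] assms[of k] by simp
  show ?thesis
  proof (induction m rule: int_induct[of _ 0])
    case (step2 i)
    then show ?case using s[of "i - 1"] by simp
  qed (simp_all add: s)
qed

lemma wind_step_scale: "wind (step l r) m n = wind (step l 1) m n / r"
  by (simp add: wind_def step_def sum_divide_distrib divide_divide_eq_left mult_ac)

text \<open>
  The shift \<open>m \<mapsto> m + 1\<close> switches the tags at the puncture, so the plain radii sit alternately
  at the vertices \<open>n - 1\<close> and \<open>n\<close> of the diagram.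
\<close>

definition radius :: "nat \<Rightarrow> (nat \<Rightarrow> int \<Rightarrow> int) \<Rightarrow> int \<Rightarrow> int" where
  "radius n b m = (if even m then b (n - 1) m else b n m)"

definition radius' :: "nat \<Rightarrow> (nat \<Rightarrow> int \<Rightarrow> int) \<Rightarrow> int \<Rightarrow> int" where
  "radius' n b m = (if even m then b n m else b (n - 1) m)"

text \<open>The relations at the ends \<open>n - 1\<close> and \<open>n\<close> have the same
  right-hand side, which makes the quotient of \<open>radius'\<close> and \<open>radius\<close> a
  constant \<open>q\<close>. With it, \<open>arc_unique\<close> gives the arcs and the periodicity,
  and the full turn of 1 identifies \<open>q\<close> with \<open>r\<close>.\<close>

lemma D_system_radius:
  assumes n: "2 \<le> n" and b: "b \<in> {1..n} \<rightarrow>\<^sub>E (UNIV \<rightarrow> {0<..})" and sys: "D_system n b"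
  defines "l \<equiv> \<lambda>m. real_of_int (radius n b m)"
  defines "r \<equiv> wind (step l 1) 0 n"
  shows "0 < r" "real_of_int (radius' n b m) = r * l m" "radial n (radius n b)"
    "j \<in> {1..n} \<Longrightarrow> real_of_int (chord n b m j) = arc l r m j"
proof -
  have bpos: "0 < b j m" if "j \<in> {1..n}" for j m
    using b that by (auto simp: PiE_iff Pi_iff)
  have lpos: "0 < radius n b m" and lpos': "0 < radius' n b m" for m
    using bpos n by (auto simp: radius_def radius'_def)
  have lp: "0 < l m" for m using lpos by (simp add: l_def)
  have ends: "radius n b m * radius' n b (m + 1) = 1 + chord n b (m + 1) (n - 1)"
    "radius' n b m * radius n b (m + 1) = 1 + chord n b (m + 1) (n - 1)" for m
    using sys unfolding D_system_iff[OF n] by (simp_all add: radius_def radius'_def)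
  define q where "q = real_of_int (radius' n b 0) / l 0"
  have q: "0 < q" using lp lpos' by (simp add: q_def)
  have ratio: "real_of_int (radius' n b m) * l (m + 1) = l m * real_of_int (radius' n b (m + 1))" for m
    using ends[of m] unfolding l_def by (metis of_int_mult)
  have rad': "real_of_int (radius' n b m) = q * l m" for m
  proof (induction m rule: int_induct[of _ 0])
    case base
    then show ?case using lp[of 0] by (simp add: q_def)
  next
    case (step1 i)
    have "l i * real_of_int (radius' n b (i + 1)) = l i * (q * l (i + 1))"
      unfolding ratio[of i, symmetric] step1(2) by (simp only: ac_simps)
    moreover have "l i \<noteq> 0" using lp[of i] by simp
    ultimately show ?case by (metis mult_left_cancel)
  next
    case (step2 i)
    have "real_of_int (radius' n b (i - 1)) * l i = l (i - 1) * real_of_int (radius' n b i)"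
      using ratio[of "i - 1"] by simp
    then have "l i * real_of_int (radius' n b (i - 1)) = l i * (q * l (i - 1))"
      unfolding step2(2) by (simp only: ac_simps)
    moreover have "l i \<noteq> 0" using lp[of i] by simp
    ultimately show ?case by (metis mult_left_cancel)
  qed
  define x where "x = (\<lambda>m j. real_of_int (chord n b m j))"
  have 1: "0 < x m j" if "j \<in> {1..n}" for m j
  proof (cases "j = 1 \<or> j = n")
    case True
    then show ?thesis using bpos[of n m] bpos[of "n - 1" m] n by (auto simp: x_def chord_def)
  next
    case False
    then have "j - 1 \<in> {1..n}" using that by auto
    then show ?thesis using bpos[of "j - 1" m] False by (simp add: x_def chord_def)
  qed
  have 2: "x m 1 = 1" for m by (simp add: x_def chord_def)
  have 3: "x m n = q * l m * l m" for m
  proof -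
    have "chord n b m n = radius' n b m * radius n b m"
      using n by (simp add: chord_def radius_def radius'_def)
    then show ?thesis using rad'[of m] by (simp add: x_def l_def)
  qed
  have 4: "q * l m * l (m + 1) = 1 + x (m + 1) (n - 1)" for m
    using arg_cong[OF ends(2)[of m], of real_of_int]
    unfolding of_int_mult of_int_add of_int_1 rad' by (simp add: x_def l_def)
  have 5: "x m j * x (m + 1) j = 1 + x m (j + 1) * x (m + 1) (j - 1)" if "j \<in> {2..n - 1}" for m j
  proof -
    have "chord n b m j * chord n b (m + 1) j = 1 + chord n b m (j + 1) * chord n b (m + 1) (j - 1)"
      using conjunct1[OF sys[unfolded D_system_iff[OF n]]] that by simp
    from arg_cong[OF this, of real_of_int] show ?thesis by (simp add: x_def)
  qed
  have A: "wind (step l q) m n = 1" "l (m + int n) = l m" for m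
    using arc_unique(1,2)[of l q n x m, OF lp q n 1 2 3 4 5] by simp_all
  have rq: "r = q"
  proof -
    have "wind (step l q) 0 n = 1" by (rule A(1))
    then show ?thesis using q wind_step_scale[of l q 0 n] by (simp add: r_def)
  qed
  have ch: "real_of_int (chord n b m j) = arc l r m j" if "j \<in> {1..n}" for m j
    using arc_unique(3)[of l q n x j m, OF lp q n 1 2 3 4 5] that by (simp add: rq x_def)
  show "0 < r" "real_of_int (radius' n b m) = r * l m"
    "j \<in> {1..n} \<Longrightarrow> real_of_int (chord n b m j) = arc l r m j"
    using q rad' ch by (simp_all add: rq)
  show "radial n (radius n b)"
    unfolding radial_def
  proof (intro conjI allI)
    fix m
    show "0 < radius n b m" by (rule lpos)
    show "radius n b (m + int n) = radius n b m"
      using A(2)[of m] by (simp add: l_def)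
    \<comment> \<open>The quotient in the divisibility is the arc of span 2 from
      \<open>m - 1\<close>, computed by the recurrence from the values 0 and 1 at spans 0 and
      1.\<close>
    have "real_of_int (chord n b (m - 1) 2) = arc l r (m - 1) (Suc (Suc 0))"
      using ch[of 2 "m - 1"] n by (simp add: numeral_2_eq_2)
    also have "\<dots> = ((l (m - 1) + l (m + 1)) / l m) * arc l r (m - 1) (Suc 0) - arc l r (m - 1) 0"
    proof (rule arc_Suc_Suc[where k = "m - 1"])
      have i: "m - 1 + 1 = m" "m - 1 + 2 = m + 1" by simp_all
      show "l (m - 1) + l (m - 1 + 2) = (l (m - 1) + l (m + 1)) / l m * l (m - 1 + 1)"
        unfolding i using lp[of m] by simp
    qed (use lp q in \<open>simp_all add: rq\<close>)
    also have "\<dots> = (l (m - 1) + l (m + 1)) / l m"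
      using arc_1[of l r "m - 1"] lp q by (simp add: rq arc_def[of _ _ _ 0])
    finally have "real_of_int (chord n b (m - 1) 2 * radius n b m) = real_of_int (radius n b (m - 1) + radius n b (m + 1))"
      using lp[of m] by (simp add: l_def)
    then have "radius n b (m - 1) + radius n b (m + 1) = radius n b m * chord n b (m - 1) 2"
      by (simp only: of_int_eq_iff mult.commute)
    then show "radius n b m dvd radius n b (m - 1) + radius n b (m + 1)" by simp
    have "r * l m \<in> \<int>" using rad'[of m] rq by (metis Ints_of_int)
    then show "wind (step (\<lambda>k. real_of_int (radius n b k)) 1) 0 n * real_of_int (radius n b m) \<in> \<int>"
      by (simp add: r_def l_def)
  qed
qed

text \<open>The notched radii are \<open>R = r l\<close>, alternating with \<open>l\<close> at the
  two ends, and \<open>X\<close> holds the arcs. Integrality comes from \<open>radial\<close> and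
  from \<open>arc_Ints\<close>, so the floors round nothing.\<close>

lemma radial_surj:
  assumes n: "2 \<le> n" and l: "radial n l"
  shows "\<exists>b \<in> {1..n} \<rightarrow>\<^sub>E (UNIV \<rightarrow> {0<..}). D_system n b \<and> radius n b = l"
proof -
  define L where "L = (\<lambda>m. real_of_int (l m))"
  define r where "r = wind (step L 1) 0 n"
  have lp: "0 < L m" "0 < l m" for m using l by (simp_all add: L_def radial_def)
  have per: "L (m + int n) = L m" for m using l by (simp add: L_def radial_def)
  have r: "0 < r" unfolding r_def using n lp by (intro wind_pos) (auto simp: step_def)
  have "r * L m \<in> \<int>" for m using l by (simp add: r_def L_def radial_def)
  moreover define R where "R m = \<lfloor>r * L m\<rfloor>" for m
  ultimately have R: "real_of_int (R m) = r * L m" for m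
    by (simp add: of_int_floor)
  have "arc L r m j \<in> \<int>" for m j
  proof (rule arc_Ints)
    show "\<exists>q\<in>\<int>. L k + L (k + 2) = q * L (k + 1)" for k
    proof -
      have "l (k + 1) dvd l (k + 1 - 1) + l (k + 1 + 1)"
        using l by (simp only: radial_def)
      then have "l (k + 1) dvd l k + l (k + 2)" by (simp add: add.assoc)
      then obtain q where "l k + l (k + 2) = l (k + 1) * q" by blast
      then have "L k + L (k + 2) = of_int q * L (k + 1)"
        unfolding L_def by (metis mult.commute of_int_add of_int_mult)
      then show ?thesis by (metis Ints_of_int)
    qed
  qed (use lp r in simp_all)
  moreover define X where "X m j = \<lfloor>arc L r m j\<rfloor>" for m j
  ultimately have X: "real_of_int (X m j) = arc L r m j" for m j
    by (simp add: of_int_floor)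
  have Rpos: "0 < R m" for m
    using R[of m] lp(1)[of m] r by (metis mult_pos_pos of_int_0_less_iff)
  have Xpos: "0 < X m j" if "0 < j" for m j
    using X[of m j] arc_pos[of L r j m] lp(1) r that by (metis of_int_0_less_iff)
  define b where "b = (\<lambda>j\<in>{1..n}. \<lambda>m. if j = n - 1 then (if even m then l m else R m)
    else if j = n then (if even m then R m else l m) else X m (j + 1))"
  have b_last: "b (n - 1) m = (if even m then l m else R m)" "b n m = (if even m then R m else l m)" for m
    using n by (auto simp: b_def)
  note b_last = b_last b_last[unfolded One_nat_def]
  have "b \<in> {1..n} \<rightarrow>\<^sub>E (UNIV \<rightarrow> {0<..})"
    using lp(2) Rpos Xpos by (auto simp: b_def)
  moreover have "radius n b = l"
    by (simp add: fun_eq_iff radius_def b_last)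
  moreover have "D_system n b"
  proof -
    have "step L r (m + int n) = step L r m" for m
      using per[of m] per[of "m + 1"] by (simp add: step_def add_ac)
    then have "wind (step L r) m n = wind (step L r) 0 n" for m
      by (rule wind_periodic)
    moreover have "wind (step L r) 0 n = 1"
      using r wind_step_scale[of L r 0 n] by (simp add: r_def)
    ultimately have w: "wind (step L r) m n = 1" for m by simp
    have ch: "real_of_int (chord n b m j) = arc L r m j" if "j \<in> {1..n}" for m j
    proof -
      consider "j = 1" | "j = n" "j \<noteq> 1" | "j \<noteq> 1" "j \<noteq> n" by blast
      then show ?thesis
      proof cases
        case 1
        then show ?thesis using arc_1[of L r m] lp(1) r by (simp add: chord_def)
      next
        case 2
        then have "chord n b m j = l m * R m" by (simp add: chord_def b_last)
        then show ?thesis using 2 R[of m] w[of m] per[of m] by (simp add: arc_def L_def)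
      next
        case 3
        then have "chord n b m j = X m j"
          using that by (auto simp: chord_def b_def)
        then show ?thesis by (simp add: X)
      qed
    qed
    \<comment> \<open>The arc from \<open>m + 1\<close> around to \<open>m\<close> has winding 1
      minus the step from \<open>m\<close> to \<open>m + 1\<close>.\<close>
    have lR: "r * L m * L (m + 1) = 1 + real_of_int (chord n b (m + 1) (n - 1))" for m
    proof -
      obtain k where k: "n = Suc k" "1 \<le> k" using n by (cases n) auto
      have "step L r m + wind (step L r) (m + 1) k = 1"
        using w[of m] unfolding k(1) wind_Suc_shift .
      moreover have "L (m + 1 + int k) = L m" using per[of m] by (simp add: k(1) add_ac)
      ultimately have "arc L r (m + 1) k = r * L (m + 1) * L m * (1 - step L r m)"
        by (simp add: arc_def eq_diff_eq add.commute)
      also have "\<dots> = r * L m * L (m + 1) - r * L m * L (m + 1) * step L r m"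
        by (simp add: algebra_simps)
      finally show ?thesis
        using ch[of k "m + 1"] k step_mult[of L r m] lp(1) r by simp
    qed
    have e: "l m * R (m + 1) = 1 + chord n b (m + 1) (n - 1)"
      "R m * l (m + 1) = 1 + chord n b (m + 1) (n - 1)" for m
    proof -
      have "real_of_int (l m * R (m + 1)) = real_of_int (1 + chord n b (m + 1) (n - 1))"
        "real_of_int (R m * l (m + 1)) = real_of_int (1 + chord n b (m + 1) (n - 1))"
        using lR[of m] R[of m] R[of "m + 1"] by (simp_all add: L_def mult_ac)
      then show "l m * R (m + 1) = 1 + chord n b (m + 1) (n - 1)"
        "R m * l (m + 1) = 1 + chord n b (m + 1) (n - 1)"
        by (simp_all only: of_int_eq_iff)
    qed
    have "chord n b m j * chord n b (m + 1) j = 1 + chord n b m (j + 1) * chord n b (m + 1) (j - 1)"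
      if "j \<in> {2..n - 1}" for m j
    proof -
      define i where "i = j - 1"
      have i: "j = Suc i" "1 \<le> i" using that by (auto simp: i_def)
      have "real_of_int (chord n b m j * chord n b (m + 1) j) =
          real_of_int (1 + chord n b m (j + 1) * chord n b (m + 1) (j - 1))"
        using that i arc_ptolemy[of L r m i] lp(1) r by (simp add: ch)
      then show ?thesis by (simp only: of_int_eq_iff)
    qed
    then show ?thesis
      unfolding D_system_iff[OF n] using e by (auto simp: b_last)
  qed
  ultimately show ?thesis by blast
qed

text \<open>For injectivity, the sequence \<open>radius n b\<close> determines \<open>r\<close>,
  hence \<open>radius'\<close> and all arcs, and these fill the rows.\<close>

lemma card_D_system:
  assumes n: "2 \<le> n"
  shows "card {b \<in> {1..n} \<rightarrow>\<^sub>E (UNIV \<rightarrow> {0<..}). D_system n b} = card {l. radial n l}"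
    (is "card ?B = _")
proof -
  have "bij_betw (radius n) ?B {l. radial n l}"
    unfolding bij_betw_def
  proof
    show "radius n ` ?B = {l. radial n l}"
      using D_system_radius(3)[OF n] radial_surj[OF n] by blast
    show "inj_on (radius n) ?B"
    proof (rule inj_onI)
      fix b c assume b: "b \<in> ?B" and c: "c \<in> ?B" and eq: "radius n b = radius n c"
      have r': "radius' n b m = radius' n c m" for m
        using D_system_radius(2)[OF n, of b m] D_system_radius(2)[OF n, of c m] b c eq by simp
      have ch: "chord n b m j = chord n c m j" if "j \<in> {1..n}" for m j
        using D_system_radius(4)[OF n _ _ that, of b m] D_system_radius(4)[OF n _ _ that, of c m] b c eq by simp
      show "b = c"
      proof (rule PiE_ext)
        show "b \<in> {1..n} \<rightarrow>\<^sub>E (UNIV \<rightarrow> {0<..})" "c \<in> {1..n} \<rightarrow>\<^sub>E (UNIV \<rightarrow> {0<..})"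
          using b c by simp_all
        fix j assume j: "j \<in> {1..n}"
        show "b j = c j"
        proof
          fix m
          consider "j = n - 1" | "j = n" | "j \<noteq> n - 1" "j \<noteq> n" by blast
          then show "b j m = c j m"
          proof cases
            case 3
            then have "Suc j \<in> {1..n}" "Suc j \<noteq> n" "j \<noteq> 0" using j by auto
            then show ?thesis using ch[of "Suc j" m] by (simp add: chord_def)
          qed (use fun_cong[OF eq, of m] r'[of m] in \<open>auto simp: radius_def radius'_def split: if_splits\<close>)
        qed
      qed
    qed
  qed
  then show ?thesis by (rule bij_betw_same_card)
qed

theorem theorem2p9:
  fixes n :: nat and E :: "(nat \<times> nat) set"
  assumes "n \<ge> 1"
    and "acyclic_orientation n (cartan_D n) E"
  shows "card (friezes_D n E) =
           (\<Sum>m=1..n. card {k. k dvd m} * ((2 * n - m - 1) choose (n - m)))"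
proof (cases "n = 1")
  case True
  \<comment> \<open>Two positive integers with product 1 are both 1, so there is one frieze for
    \<open>n = 1\<close>; the sum has the single term 1.\<close>
  have "{a \<in> {1} \<rightarrow>\<^sub>E (UNIV \<rightarrow> {0<..}). \<forall>m. a 1 m * a 1 (m + 1) = 1} =
      {\<lambda>j\<in>{1::nat}. \<lambda>m::int. 1::int}" (is "?A = {?f}")
  proof (intro equalityI subsetI)
    fix a assume a: "a \<in> ?A"
    have one: "a 1 m = 1" for m
    proof -
      have "0 < a 1 m" "a 1 m * a 1 (m + 1) = 1" using a by (auto simp: PiE_iff Pi_iff)
      then show ?thesis using pos_zmult_eq_1_iff by blast
    qed
    have "a = ?f"
      using a by (intro PiE_ext[of a "{1}" "\<lambda>_. UNIV \<rightarrow> {0<..}"]) (auto simp: one[simplified] fun_eq_iff)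
    then show "a \<in> {?f}" by simp
  qed auto
  then have "card (friezes_D n E) = 1" by (simp add: friezes_D_def True)
  then show ?thesis by (simp add: True)
next
  case False
  then have n: "2 \<le> n" using assms(1) by simp
  have "card (friezes_D n E) = card (friezes n (cartan_D n) E)"
    using False by (simp add: friezes_D_def)
  also have "\<dots> = card (radii n)"
    using card_friezes_eq[OF assms(2)] card_D_system[OF n] card_radial[of n] n by simp
  also have "\<dots> = (\<Sum>m=1..n. card {k. k dvd m} * ((2 * n - m - 1) choose (n - m)))"
    using card_radii n by simp
  finally show ?thesis .
qed

end
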